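(* Let $N\ge 1$, $K\ge 1$ be integers. Let $(M_n)_{n\ge0}$ be a non-decreasing sequence of positive real numbers with $M_0=1$ which satisfies (lc) and (mg). Let $m_0=(m_0(n))_{n\ge 0},m_1=(m_1(n))_{n\ge0},\dots,m_N=(m_N(n))_{n\ge0}$ be $(M_n)$-sequences of orders $s_0,s_1,\dots,s_N\ge 0$, respectively, and put $\boldsymbol{m}=(m_1,\dots,m_N)$, $\boldsymbol{s}=(s_1,\dots,s_N)$. Let $\Lambda$ be a finite subset of $\mathbb{N}_0\times\mathbb{N}_0^N$, let $a_{j\boldsymbol{\alpha}}(t)\in\mathbb{C}[[t]]$ for $(j,\boldsymbol{\alpha})\in\Lambda$, and put $$P(\partial_{m_0,t},\partial_{\boldsymbol{m},\boldsymbol{z}})=\partial_{m_0,t}^{K}+\sum_{(j,\boldsymbol{\alpha})\in \Lambda}a_{j\boldsymbol{\alpha}}(t)\,\partial_{m_0,t}^j\partial_{\boldsymbol{m},\boldsymbol{z}}^{\boldsymbol{\alpha}}.$$ Let $1/k_1\in[0,\infty)$ be the number $$\frac{1}{k_1}=\max\left\{0,\max_{(j,\boldsymbol{\alpha})\in\Lambda}\frac{s_0(j-K)+\boldsymbol{s}\cdot\boldsymbol{\alpha}}{q_{j\boldsymbol{\alpha}}}\right\},\qquad q_{j\boldsymbol{\alpha}}=\mathrm{ord}_t(a_{j\boldsymbol{\alpha}})-j+K.$$ Assume that: (a) $\mathrm{ord}_t(a_{j\boldsymbol{\alpha}})\ge\max\{0,j-K+1\}$ for all $(j,\boldsymbol{\alpha})\in\Lambda$;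 (b) for some $R>0$, $\varphi_j\in\mathcal{O}(D_R^N)$ for $j=0,1,\dots,K-1$ and $f\in\mathcal{O}(D_R^N)[[t]]^{(M_n)}_{1/k_1}$; (c) $a_{j\boldsymbol{\alpha}}(t)\in\mathbb{C}[[t]]^{(M_n)}_{1/k_1}$ for all $(j,\boldsymbol{\alpha})\in\Lambda$; (d) $m_0$ is a regular $(M_n)$-sequence of order $s_0$. Let $\hat u(t,\boldsymbol{z})=\sum_{n\ge0}u_n(\boldsymbol{z})t^n$ be a formal solution of the Cauchy problem $$P(\partial_{m_0,t},\partial_{\boldsymbol{m},\boldsymbol{z}})u(t,\boldsymbol{z})=f(t,\boldsymbol{z}),\qquad \partial_{m_0,t}^ju(0,\boldsymbol{z})=\varphi_j(\boldsymbol{z}),\quad j=0,\dots,K-1.$$ Then $\hat u(t,\boldsymbol{z})\in\mathcal{O}(D_r^N)[[t]]^{(M_n)}_{1/k_1}$ for some $r\in(0,R)$; that is, for every $r'\in(0,r)$ there exist $\tilde C,\tilde H>0$ such that $$\sup_{\boldsymbol{z}\in D_{r'}^N}|u_n(\boldsymbol{z})|\le\tilde C\tilde H^n(M_n)^{1/k_1},\qquad n\in\mathbb{N}_0.$$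
   Context: Notation: $\mathbb{N}=\{1,2,\dots\}$, $\mathbb{N}_0=\mathbb{N}\cup\{0\}$; $D_R^N=\{(z_1,\dots,z_N)\in\mathbb{C}^N: |z_j|<R,\ j=1,\dots,N\}$; $\mathcal{O}(D_R^N)$ is the set of holomorphic functions on $D_R^N$; $\boldsymbol{\alpha}\cdot\boldsymbol{s}=\alpha_1s_1+\dots+\alpha_Ns_N$. A sequence $(M_n)_{n\ge 0}$ of positive reals with $M_0=1$ satisfies (lc) if $M_n^2\le M_{n-1}M_{n+1}$ for all $n\ge1$; it satisfies (mg) if there is $B>0$ with $M_{n+k}\le B^{n+k}M_nM_k$ for all $n,k\ge0$. A sequence of positive reals $(m(n))_{n\ge0}$ is an $(M_n)$-sequence of order $s\in\mathbb{R}$ if there are $\mathfrak{a},\mathfrak{A}>0$ with $\mathfrak{a}^n(M_n)^s\le m(n)\le\mathfrak{A}^n(M_n)^s$ for all $n\ge0$. It is a regular $(M_n)$-sequence of order $s$ if there are $\mathfrak{a},\mathfrak{A}>0$ with $\mathfrak{a}(M_n/M_{n-1})^s\le m(n)/m(n-1)\le\mathfrak{A}(M_n/M_{n-1})^s$ for all $n\ge1$. For a sequence $m=(m(n))_{n\ge0}$ of positive reals, the $m$-differential operator is the operator on formal power series in $z$ given by $\partial_{m,z}\left(\sum_{n\ge0}\frac{u_n}{m(n)}z^n\right)=\sum_{n\ge0}\frac{u_{n+1}}{m(n)}z^n$; it acts with the other variables as parameters (coefficientwise). For $\boldsymbol{\alpha}\in\mathbb{N}_0^N$, $\partial_{\boldsymbol{m},\boldsymbol{z}}^{\boldsymbol{\alpha}}=\partial_{m_1,z_1}^{\alpha_1}\cdots\partial_{m_N,z_N}^{\alpha_N}$.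 For $s\in\mathbb{R}$, $\mathbb{C}[[t]]^{(M_n)}_s$ is the set of $\sum_{n\ge0} a_nt^n\in\mathbb{C}[[t]]$ for which there are $A,B>0$ with $|a_n|\le AB^n(M_n)^s$ for all $n\ge0$. $\mathcal{O}(D_R^N)[[t]]^{(M_n)}_s$ is the set of $\sum_{n\ge0}g_n(\boldsymbol{z})t^n$ with $g_n\in\mathcal{O}(D_R^N)$ such that for every $r\in(0,R)$ there are $A,B>0$ with $|g_n(\boldsymbol{z})|\le AB^n(M_n)^s$ for all $\boldsymbol{z}\in D_r^N$ and $n\ge0$. $\mathrm{ord}_t(a)$ is the order of vanishing of $a(t)$ at $t=0$ ($+\infty$ if $a=0$, in which case the corresponding quotient is read as $0$). The number $k_1$ is the first positive slope of the Newton polygon of $P$; only $1/k_1$, defined by the formula in the statement, is used ($1/k_1=0$ is allowed). A formal solution is a formal power series in $t$ (with coefficients power series in $\boldsymbol{z}$) satisfying the equation and initial conditions formally; functions holomorphic near $\boldsymbol 0$ are identified with their Taylor series. *)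

theory Defs
  imports "HOL-Analysis.Analysis" "HOL-Computational_Algebra.Formal_Power_Series"
begin

section \<open>Weight sequences\<close>

definition log_convex_seq :: "(nat \<Rightarrow> real) \<Rightarrow> bool" where
  "log_convex_seq M \<longleftrightarrow> (\<forall>n\<ge>1. (M n)\<^sup>2 \<le> M (n - 1) * M (n + 1))"

definition moderate_growth :: "(nat \<Rightarrow> real) \<Rightarrow> bool" where
  "moderate_growth M \<longleftrightarrow> (\<exists>B>0. \<forall>n k. M (n + k) \<le> B ^ (n + k) * M n * M k)"

definition M_sequence :: "(nat \<Rightarrow> real) \<Rightarrow> real \<Rightarrow> (nat \<Rightarrow> real) \<Rightarrow> bool" where
  "M_sequence M s m \<longleftrightarrow> (\<forall>n. m n > 0) \<and>
     (\<exists>a>0. \<exists>A>0. \<forall>n. a ^ n * M n powr s \<le> m n \<and> m n \<le> A ^ n * M n powr s)"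

definition regular_M_sequence :: "(nat \<Rightarrow> real) \<Rightarrow> real \<Rightarrow> (nat \<Rightarrow> real) \<Rightarrow> bool" where
  "regular_M_sequence M s m \<longleftrightarrow> (\<forall>n. m n > 0) \<and>
     (\<exists>a>0. \<exists>A>0. \<forall>n\<ge>1.
        a * (M n / M (n - 1)) powr s \<le> m n / m (n - 1) \<and>
        m n / m (n - 1) \<le> A * (M n / M (n - 1)) powr s)"


section \<open>Holomorphic functions on polydiscs\<close>

definition polydisc :: "real \<Rightarrow> (complex ^ 'n) set" where
  "polydisc R = {z. \<forall>i. cmod (z $ i) < R}"

text \<open>Complex differentiability at every point: the real Frechet derivative exists and is
  complex linear.  It is meant for open sets.\<close>

definition holomorphic_several :: "(complex ^ 'n \<Rightarrow> complex) \<Rightarrow> (complex ^ 'n) set \<Rightarrow> bool" where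
  "holomorphic_several g S \<longleftrightarrow>
     (\<forall>z\<in>S. \<exists>D. (g has_derivative D) (at z) \<and> (\<forall>c v. D (c *s v) = c * D v))"

text \<open>A power series in \<open>z\<close> is the family of its coefficients, indexed by multi-indices
  \<open>'n \<Rightarrow> nat\<close>.  The following is the analogue of \<open>has_fps_expansion\<close>: the series converges
  (unconditionally) to \<open>g\<close> near the origin.  The coefficients are then determined by \<open>g\<close>:
  they are its Taylor coefficients at the origin.\<close>

definition has_mps_expansion ::
    "(complex ^ 'n \<Rightarrow> complex) \<Rightarrow> (('n \<Rightarrow> nat) \<Rightarrow> complex) \<Rightarrow> bool" where
  "has_mps_expansion g c \<longleftrightarrow>
     (\<exists>\<rho>>0. \<forall>z\<in>polydisc \<rho>. ((\<lambda>\<alpha>. c \<alpha> * (\<Prod>i\<in>UNIV. (z $ i) ^ \<alpha> i)) has_sum g z) UNIV)"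


section \<open>Gevrey-type classes\<close>

definition gevrey_fps :: "(nat \<Rightarrow> real) \<Rightarrow> real \<Rightarrow> complex fps set" where
  "gevrey_fps M s = {a. \<exists>A>0. \<exists>B>0. \<forall>n. cmod (fps_nth a n) \<le> A * B ^ n * M n powr s}"

text \<open>The sequence \<open>g\<close> stands for the formal power series with coefficient \<open>g n\<close> at
  \<open>t ^ n\<close>.\<close>

definition gevrey_holomorphic ::
    "real \<Rightarrow> (nat \<Rightarrow> real) \<Rightarrow> real \<Rightarrow> (nat \<Rightarrow> complex ^ 'n \<Rightarrow> complex) set" where
  "gevrey_holomorphic R M s =
     {g. (\<forall>n. holomorphic_several (g n) (polydisc R)) \<and>
         (\<forall>r. 0 < r \<and> r < R \<longrightarrow>
            (\<exists>A>0. \<exists>B>0. \<forall>z\<in>polydisc r. \<forall>n. cmod (g n z) \<le> A * B ^ n * M n powr s))}"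


section \<open>Differential operators attached to sequences\<close>

text \<open>A formal power series in \<open>t\<close> and \<open>z\<close> is a function \<open>u\<close> with \<open>u n \<gamma>\<close> the coefficient of
  \<open>t ^ n\<close> times the monomial with exponent \<open>\<gamma>\<close>.  Writing the coefficient at \<open>n\<close> as
  \<open>v n / m n\<close>, the operator shifts \<open>v\<close>, so the new coefficient is
  \<open>v (n + 1) / m n\<close>, where \<open>v (n + 1)\<close> is \<open>m (n + 1)\<close> times the old coefficient at
  \<open>n + 1\<close>.\<close>

definition mdiff_t ::
    "(nat \<Rightarrow> real) \<Rightarrow> (nat \<Rightarrow> ('n \<Rightarrow> nat) \<Rightarrow> complex) \<Rightarrow> nat \<Rightarrow> ('n \<Rightarrow> nat) \<Rightarrow> complex" where
  "mdiff_t m u = (\<lambda>n \<gamma>. of_real (m (Suc n)) * u (Suc n) \<gamma> / of_real (m n))"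

definition mdiff_z ::
    "(nat \<Rightarrow> real) \<Rightarrow> 'n \<Rightarrow> (('n \<Rightarrow> nat) \<Rightarrow> complex) \<Rightarrow> ('n \<Rightarrow> nat) \<Rightarrow> complex" where
  "mdiff_z m i c = (\<lambda>\<gamma>. of_real (m (Suc (\<gamma> i))) * c (\<gamma>(i := Suc (\<gamma> i))) / of_real (m (\<gamma> i)))"

text \<open>The composition over all \<open>i\<close> of the \<open>\<alpha> i\<close>-fold iterates of the operators in the
  \<open>i\<close>-th variable.  These commute, so the order of composition is irrelevant and \<open>fold\<close> is
  well defined (\<open>mdiff_z_commute\<close>).\<close>

definition mdiff_multi ::
    "('n \<Rightarrow> nat \<Rightarrow> real) \<Rightarrow> ('n \<Rightarrow> nat) \<Rightarrow> (('n \<Rightarrow> nat) \<Rightarrow> complex) \<Rightarrow> ('n \<Rightarrow> nat) \<Rightarrow> complex" where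
  "mdiff_multi m \<alpha> c = Finite_Set.fold (\<lambda>i. mdiff_z (m i) i ^^ \<alpha> i) c UNIV"

lemma mdiff_z_commute_single:
  "mdiff_z (m i) i \<circ> mdiff_z (m j) j = mdiff_z (m j) j \<circ> mdiff_z (m i) i"
  by (cases "i = j") (auto simp: mdiff_z_def fun_eq_iff fun_upd_twist mult_ac)

lemma funpow_commute:
  fixes f g :: "'a \<Rightarrow> 'a"
  assumes "f \<circ> g = g \<circ> f"
  shows "(f ^^ k) \<circ> (g ^^ l) = (g ^^ l) \<circ> (f ^^ k)"
proof -
  have *: "(p ^^ n) \<circ> h = h \<circ> (p ^^ n)" if "p \<circ> h = h \<circ> p" for p h :: "'a \<Rightarrow> 'a" and n
    using that by (induction n) (auto simp: fun_eq_iff)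
  have "f \<circ> (g ^^ l) = (g ^^ l) \<circ> f"
    using *[of g f l] assms by simp
  then show ?thesis by (rule *)
qed

lemma mdiff_z_commute: "comp_fun_commute (\<lambda>i. mdiff_z (m i) i ^^ \<alpha> i)"
  by unfold_locales (rule funpow_commute[OF mdiff_z_commute_single])

lemma mdiff_z_funpow:
  assumes "\<And>n. m n > 0"
  shows "(mdiff_z m i ^^ k) c \<gamma> =
    of_real (m (\<gamma> i + k) / m (\<gamma> i)) * c (\<gamma>(i := \<gamma> i + k))"
proof (induction k arbitrary: \<gamma>)
  case 0
  then show ?case using assms[of "\<gamma> i"] by simp
next
  case (Suc k)
  have "\<gamma>(i := Suc (\<gamma> i), i := Suc (\<gamma> i + k)) = \<gamma>(i := Suc (\<gamma> i + k))" by simp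
  then show ?case
    using Suc.IH[of "\<gamma>(i := Suc (\<gamma> i))"] assms[of "Suc (\<gamma> i)"]
    by (simp add: mdiff_z_def[of m i "(mdiff_z m i ^^ k) c"] del: fun_upd_apply)
       (simp add: field_simps)
qed

lemma mdiff_multi_coeff:
  fixes m :: "'n::finite \<Rightarrow> nat \<Rightarrow> real"
  assumes pos: "\<And>i n. m i n > 0"
  shows "mdiff_multi m \<alpha> c \<gamma> =
    of_real (\<Prod>i\<in>UNIV. m i (\<gamma> i + \<alpha> i) / m i (\<gamma> i)) * c (\<lambda>i. \<gamma> i + \<alpha> i)"
proof -
  interpret comp_fun_commute "\<lambda>i. mdiff_z (m i) i ^^ \<alpha> i" by (rule mdiff_z_commute)
  have "Finite_Set.fold (\<lambda>i. mdiff_z (m i) i ^^ \<alpha> i) c A \<gamma> =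
      of_real (\<Prod>i\<in>A. m i (\<gamma> i + \<alpha> i) / m i (\<gamma> i)) *
      c (\<lambda>i. if i \<in> A then \<gamma> i + \<alpha> i else \<gamma> i)" if "finite A" for A \<gamma>
    using that
  proof (induction A arbitrary: \<gamma> rule: finite_induct)
    case empty
    then show ?case by simp
  next
    case (insert x A)
    have 1: "(\<Prod>i\<in>A. m i ((\<gamma>(x := \<gamma> x + \<alpha> x)) i + \<alpha> i) / m i ((\<gamma>(x := \<gamma> x + \<alpha> x)) i)) =
        (\<Prod>i\<in>A. m i (\<gamma> i + \<alpha> i) / m i (\<gamma> i))"
      using insert.hyps by (intro prod.cong) auto
    have 2: "(\<lambda>i. if i \<in> A then (\<gamma>(x := \<gamma> x + \<alpha> x)) i + \<alpha> i else (\<gamma>(x := \<gamma> x + \<alpha> x)) i) =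
        (\<lambda>i. if i \<in> insert x A then \<gamma> i + \<alpha> i else \<gamma> i)"
      using insert.hyps by auto
    have "Finite_Set.fold (\<lambda>i. mdiff_z (m i) i ^^ \<alpha> i) c (insert x A) \<gamma> =
        of_real (m x (\<gamma> x + \<alpha> x) / m x (\<gamma> x)) *
        Finite_Set.fold (\<lambda>i. mdiff_z (m i) i ^^ \<alpha> i) c A (\<gamma>(x := \<gamma> x + \<alpha> x))"
      unfolding fold_insert[OF insert.hyps] by (rule mdiff_z_funpow[OF pos])
    also have "\<dots> = of_real (\<Prod>i\<in>insert x A. m i (\<gamma> i + \<alpha> i) / m i (\<gamma> i)) *
        c (\<lambda>i. if i \<in> insert x A then \<gamma> i + \<alpha> i else \<gamma> i)"
      unfolding insert.IH 1 2 prod.insert[OF insert.hyps] of_real_mult by (rule mult.assoc[symmetric])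
    finally show ?case .
  qed
  from this[of UNIV] show ?thesis by (simp add: mdiff_multi_def)
qed


section \<open>The Cauchy problem\<close>

definition mult_t :: "complex fps \<Rightarrow> (nat \<Rightarrow> ('n \<Rightarrow> nat) \<Rightarrow> complex) \<Rightarrow> nat \<Rightarrow> ('n \<Rightarrow> nat) \<Rightarrow> complex" where
  "mult_t a u = (\<lambda>n \<gamma>. fps_nth (a * Abs_fps (\<lambda>k. u k \<gamma>)) n)"

definition P_op ::
    "nat \<Rightarrow> (nat \<Rightarrow> real) \<Rightarrow> ('n \<Rightarrow> nat \<Rightarrow> real) \<Rightarrow> (nat \<times> ('n \<Rightarrow> nat)) set \<Rightarrow>
     (nat \<Rightarrow> ('n \<Rightarrow> nat) \<Rightarrow> complex fps) \<Rightarrow>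
     (nat \<Rightarrow> ('n \<Rightarrow> nat) \<Rightarrow> complex) \<Rightarrow> nat \<Rightarrow> ('n \<Rightarrow> nat) \<Rightarrow> complex" where
  "P_op K m0 m \<Lambda> a u = (\<lambda>n \<gamma>. (mdiff_t m0 ^^ K) u n \<gamma> +
     (\<Sum>(j, \<alpha>)\<in>\<Lambda>. mult_t (a j \<alpha>) ((mdiff_t m0 ^^ j) (\<lambda>k. mdiff_multi m \<alpha> (u k))) n \<gamma>))"

text \<open>Both the equation and the initial conditions equate power series in \<open>z\<close> with the Taylor
  series of holomorphic functions.\<close>

definition formal_solution ::
    "nat \<Rightarrow> (nat \<Rightarrow> real) \<Rightarrow> ('n \<Rightarrow> nat \<Rightarrow> real) \<Rightarrow> (nat \<times> ('n \<Rightarrow> nat)) set \<Rightarrow>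
     (nat \<Rightarrow> ('n \<Rightarrow> nat) \<Rightarrow> complex fps) \<Rightarrow> (nat \<Rightarrow> complex ^ 'n \<Rightarrow> complex) \<Rightarrow>
     (nat \<Rightarrow> complex ^ 'n \<Rightarrow> complex) \<Rightarrow> (nat \<Rightarrow> ('n \<Rightarrow> nat) \<Rightarrow> complex) \<Rightarrow> bool" where
  "formal_solution K m0 m \<Lambda> a f \<phi> u \<longleftrightarrow>
     (\<forall>n. has_mps_expansion (f n) (P_op K m0 m \<Lambda> a u n)) \<and>
     (\<forall>j<K. has_mps_expansion (\<phi> j) ((mdiff_t m0 ^^ j) u 0))"

text \<open>The number \<open>1 / k\<^sub>1\<close>.  A vanishing coefficient has infinite order and contributes the
  quotient \<open>0\<close>; it is treated separately because \<open>subdegree 0 = 0\<close>.\<close>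

definition inv_k1 ::
    "nat \<Rightarrow> real \<Rightarrow> ('n::finite \<Rightarrow> real) \<Rightarrow> (nat \<times> ('n \<Rightarrow> nat)) set \<Rightarrow>
     (nat \<Rightarrow> ('n \<Rightarrow> nat) \<Rightarrow> complex fps) \<Rightarrow> real" where
  "inv_k1 K s0 s \<Lambda> a = Max (insert 0 ((\<lambda>(j, \<alpha>).
     if a j \<alpha> = 0 then 0
     else (s0 * (real j - real K) + (\<Sum>i\<in>UNIV. s i * real (\<alpha> i))) /
          (real (subdegree (a j \<alpha>)) - real j + real K)) ` \<Lambda>))"

end

theory Submission
  imports Defs "HOL-Complex_Analysis.Complex_Analysis"
begin

text \<open>
  Multiplying the coefficient of \<open>t ^ N\<close> and \<open>z ^ \<delta>\<close> by \<open>m0 N * (\<Prod>i. m i (\<delta> i))\<close> turns all the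
  operators into shifts, so no factor depending on \<open>\<delta>\<close> is lost in the recursion, in which the
  coefficient at \<open>(N, \<delta>)\<close> depends on those at \<open>(N - p, \<delta> + \<alpha>)\<close> with \<open>p \<ge> 1\<close>.  To estimate the
  coefficient at \<open>(N0, \<gamma>)\<close>, only the indices \<open>(N, \<gamma> + \<beta>)\<close> with \<open>N \<le> N0\<close> and
  \<open>\<beta> i \<le> 2 ^ D * (N0 - N)\<close> matter.  There all growth of \<open>M\<close> is measured by the single number
  \<open>L = M (N0 + 1) / M N0\<close>: log-convexity bounds the earlier quotients by \<open>L\<close>, moderate growth those up
  to \<open>2 ^ D * N0\<close> by a constant times \<open>L\<close>, and \<open>L ^ N0\<close> by \<open>M N0\<close> up to a geometric factor.
  Each step of the recursion then changes the exponent of \<open>L\<close> favourably exactly when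
  \<open>s \<cdot> \<alpha> \<le> (1 / k\<^sub>1) q + s0 (K - j)\<close>, which is the definition of \<open>1 / k\<^sub>1\<close>.
\<close>

section \<open>Power series in several variables\<close>

lemma digits_unique:
  fixes x y :: "nat \<Rightarrow> nat"
  assumes "\<And>i. x i < b" "\<And>i. y i < b"
    and "(\<Sum>i<N. x i * b ^ i) = (\<Sum>i<N. y i * b ^ i)" and "i < N"
  shows "x i = y i"
  using assms
proof (induction N arbitrary: x y i)
  case (Suc N)
  have shift: "(\<Sum>i<Suc N. z i * b ^ i) = z 0 + b * (\<Sum>i<N. z (Suc i) * b ^ i)" for z :: "nat \<Rightarrow> nat"
    by (simp only: sum.lessThan_Suc_shift sum_distrib_left) (simp add: mult_ac)
  have b: "b > 0" using Suc.prems(1)[of 0] by simp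
  have eq: "x 0 + b * (\<Sum>i<N. x (Suc i) * b ^ i) = y 0 + b * (\<Sum>i<N. y (Suc i) * b ^ i)"
    using Suc.prems(3) unfolding shift .
  have 0: "x 0 = y 0"
    using arg_cong[OF eq, of "\<lambda>t. t mod b"] Suc.prems(1,2)[of 0] by simp
  have "(\<Sum>i<N. x (Suc i) * b ^ i) = (\<Sum>i<N. y (Suc i) * b ^ i)"
    using eq 0 b by simp
  then have "x (Suc i) = y (Suc i)" if "i < N" for i
    using Suc.IH[of "\<lambda>i. x (Suc i)" "\<lambda>i. y (Suc i)" i] Suc.prems(1,2) that by simp
  then show ?case using 0 Suc.prems(4) by (cases i) auto
qed simp

text \<open>Take \<open>k i = L + b ^ e i\<close>. The weighted sum is then \<open>L\<close> times
  the total degree plus a remainder. For \<open>L\<close> large it fixes the total degree, after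
  which the remainder is a base \<open>b\<close> expansion whose digits are the entries of the
  multi-index.\<close>

lemma isolating_weights:
  fixes \<gamma> :: "'n::finite \<Rightarrow> nat"
  obtains k :: "'n \<Rightarrow> nat" where "\<And>i. k i \<ge> 1"
    and "\<And>\<gamma>'. (\<Sum>i\<in>UNIV. k i * \<gamma>' i) = (\<Sum>i\<in>UNIV. k i * \<gamma> i) \<Longrightarrow> \<gamma>' = \<gamma>"
proof -
  define N where "N = CARD('n)"
  obtain e :: "'n \<Rightarrow> nat" where e: "bij_betw e UNIV {..<N}"
    using ex_bij_betw_finite_nat[of "UNIV :: 'n set"] by (auto simp: N_def atLeast0LessThan)
  define n where "n = (\<Sum>i\<in>UNIV. \<gamma> i)"
  define b where "b = n + 1"
  \<comment> \<open>By \<open>bound\<close> below, the remainder of a multi-index of degree at most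
    \<open>n\<close> is at most \<open>n * b ^ N\<close>, hence less than \<open>L\<close>.\<close>
  define L where "L = n * b ^ N + 1"
  define k where "k i = L + b ^ e i" for i
  have bound: "(\<Sum>i\<in>UNIV. b ^ e i * \<delta> i) \<le> b ^ N * (\<Sum>i\<in>UNIV. \<delta> i)" for \<delta> :: "'n \<Rightarrow> nat"
  proof -
    have "e i \<le> N" for i using bij_betwE[OF e] by (auto intro: less_imp_le)
    then have "b ^ e i \<le> b ^ N" for i by (simp add: b_def power_increasing)
    then show ?thesis by (auto simp: sum_distrib_left intro!: sum_mono)
  qed
  have expand: "(\<Sum>i\<in>UNIV. k i * \<delta> i) = L * (\<Sum>i\<in>UNIV. \<delta> i) + (\<Sum>i\<in>UNIV. b ^ e i * \<delta> i)" for \<delta> :: "'n \<Rightarrow> nat"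
    by (simp add: k_def algebra_simps sum.distrib sum_distrib_left)
  have le: "\<delta> i \<le> (\<Sum>i\<in>UNIV. \<delta> i)" for \<delta> :: "'n \<Rightarrow> nat" and i
    by (rule member_le_sum) auto
  have uniq: "\<gamma>' = \<gamma>" if eq: "(\<Sum>i\<in>UNIV. k i * \<gamma>' i) = (\<Sum>i\<in>UNIV. k i * \<gamma> i)" for \<gamma>'
  proof -
    define n' where "n' = (\<Sum>i\<in>UNIV. \<gamma>' i)"
    define S where "S = (\<Sum>i\<in>UNIV. b ^ e i * \<gamma> i)"
    define S' where "S' = (\<Sum>i\<in>UNIV. b ^ e i * \<gamma>' i)"
    have *: "L * n' + S' = L * n + S"
      using eq unfolding expand n_def n'_def S_def S'_def .
    have S: "S \<le> b ^ N * n" "S' \<le> b ^ N * n'"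
      using bound[of \<gamma>] bound[of \<gamma>'] by (simp_all add: S_def S'_def n_def n'_def)
    have n': "n' = n"
    proof (rule linorder_cases[of n' n])
      assume "n' < n"
      then have "L * n' + L \<le> L * n" using mult_le_mono2[of "Suc n'" n L] by simp
      moreover have "b ^ N * n' \<le> b ^ N * n" using \<open>n' < n\<close> by simp
      then have "S' < L" using S(2) unfolding L_def mult.commute[of n] by linarith
      ultimately show ?thesis using * by linarith
    next
      \<comment> \<open>The remainder \<open>S'\<close> is not controlled here, but it only enlarges
        the side that is already too big; a bound on \<open>S\<close> suffices.\<close>
      assume "n < n'"
      then have "L * n + L \<le> L * n'" using mult_le_mono2[of "Suc n" n' L] by simp
      moreover have "S < L" using S(1) by (simp add: L_def mult.commute)
      ultimately show ?thesis using * by linarith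
    qed
    have SS: "S' = S" using * n' by simp
    define x where "x \<delta> j = (if j < N then \<delta> (inv_into UNIV e j) else 0)" for \<delta> :: "'n \<Rightarrow> nat" and j
    have ex: "(\<Sum>i\<in>UNIV. b ^ e i * \<delta> i) = (\<Sum>j<N. x \<delta> j * b ^ j)" for \<delta>
    proof -
      have "(\<Sum>j<N. x \<delta> j * b ^ j) = (\<Sum>i\<in>UNIV. x \<delta> (e i) * b ^ e i)"
        by (rule sum.reindex_bij_betw[OF e, symmetric])
      also have "\<dots> = (\<Sum>i\<in>UNIV. b ^ e i * \<delta> i)"
        using e bij_betwE[OF e] by (intro sum.cong) (auto simp: x_def bij_betw_def mult.commute)
      finally show ?thesis by simp
    qed
    \<comment> \<open>Equal degrees \<open>n\<close> force every entry to be at most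
      \<open>n\<close>, an admissible digit in base \<open>b = n + 1\<close>.\<close>
    have lt: "x \<gamma> j < b" "x \<gamma>' j < b" for j
      using le[of \<gamma>] le[of \<gamma>'] n' by (auto simp: x_def b_def n_def n'_def less_Suc_eq_le)
    have "x \<gamma>' j = x \<gamma> j" if "j < N" for j
      using digits_unique[where x = "x \<gamma>'" and y = "x \<gamma>", OF lt(2) lt(1)] that SS
      by (simp add: S_def S'_def ex)
    then have "x \<gamma>' (e i) = x \<gamma> (e i)" for i using bij_betwE[OF e] by auto
    then show "\<gamma>' = \<gamma>" using e bij_betwE[OF e] by (auto simp: x_def bij_betw_def fun_eq_iff)
  qed
  show ?thesis by (rule that[of k, OF _ uniq]) (simp_all add: k_def L_def)
qed

text \<open>Reduces to one complex variable: the derivative \<open>D\<close> of \<open>g\<close> is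
  complex linear, so the chain rule gives \<open>D (h *s v) = h * D v\<close>, and the composite is
  complex differentiable with derivative \<open>D v\<close>.\<close>

lemma holomorphic_several_curve:
  fixes g :: "complex ^ 'n::finite \<Rightarrow> complex" and p :: "complex \<Rightarrow> complex ^ 'n"
    and v :: "complex ^ 'n"
  assumes "holomorphic_several g S" and "p w \<in> S"
    and "\<And>i. ((\<lambda>w. p w $ i) has_field_derivative v $ i) (at w)"
  shows "\<exists>d. ((\<lambda>w. g (p w)) has_field_derivative d) (at w)"
proof -
  obtain D where D: "(g has_derivative D) (at (p w))" "\<And>c v. D (c *s v) = c * D v"
    using assms(1,2) unfolding holomorphic_several_def by blast
  have "(p has_derivative (\<lambda>h. h *s v)) (at w)"
    unfolding has_derivative_componentwise_within[of p]
  proof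
    fix b :: "complex ^ 'n" assume "b \<in> Basis"
    then obtain i u where b: "b = axis i u" by (auto simp: Basis_vec_def)
    show "((\<lambda>x. p x \<bullet> b) has_derivative (\<lambda>h. (h *s v) \<bullet> b)) (at w)"
      using has_derivative_inner_left[OF assms(3)[of i, unfolded has_field_derivative_def], of u]
      by (simp add: b inner_axis mult.commute)
  qed
  then have "((\<lambda>w. g (p w)) has_derivative (\<lambda>h. D (h *s v))) (at w)"
    by (rule has_derivative_compose) (use D in simp)
  then have "((\<lambda>w. g (p w)) has_field_derivative D v) (at w)"
    unfolding has_field_derivative_def D(2) by (simp add: mult_commute_abs)
  then show ?thesis by blast
qed

text \<open>
  With isolating weights \<open>k\<close>, the coefficient of \<open>g\<close> at \<open>\<gamma>\<close> times \<open>r ^ (\<Sum>i. \<gamma> i)\<close> is a single Taylor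
  coefficient of the one-variable function obtained by substituting \<open>z $ i = r * w ^ k i\<close>, so the
  one-variable Cauchy inequality applies.
\<close>

lemma has_mps_expansion_Cauchy_estimate:
  fixes g :: "complex ^ 'n::finite \<Rightarrow> complex"
  assumes hol: "holomorphic_several g (polydisc R)" and exp: "has_mps_expansion g c"
    and r: "0 < r" "r < R" and B: "\<And>z. z \<in> polydisc R \<Longrightarrow> cmod (g z) \<le> B"
  shows "cmod (c \<gamma>) * r ^ (\<Sum>i\<in>UNIV. \<gamma> i) \<le> B"
proof -
  obtain k :: "'n \<Rightarrow> nat" where k: "\<And>i. k i \<ge> 1"
    and uniq: "\<And>\<gamma>'. (\<Sum>i\<in>UNIV. k i * \<gamma>' i) = (\<Sum>i\<in>UNIV. k i * \<gamma> i) \<Longrightarrow> \<gamma>' = \<gamma>"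
    using isolating_weights[of \<gamma>] by metis
  define \<kappa> where "\<kappa> \<delta> = (\<Sum>i\<in>UNIV. k i * \<delta> i)" for \<delta> :: "'n \<Rightarrow> nat"
  define p :: "complex \<Rightarrow> complex ^ 'n" where "p w = (\<chi> i. of_real r * w ^ k i)" for w
  define h where "h w = g (p w)" for w
  \<comment> \<open>The exponents \<open>k i\<close> are at least 1, so on the closed unit disc the
    curve stays within radius \<open>r < R\<close>, and near 0 it enters every small
    polydisc.\<close>
  have pw_le: "cmod (p w $ i) \<le> r * cmod w" if "cmod w \<le> 1" for w i
  proof -
    have "cmod w ^ k i \<le> cmod w ^ 1" by (rule power_decreasing) (use k that in auto)
    then show ?thesis using r by (simp add: p_def norm_mult norm_power)
  qed
  have p_in: "p w \<in> polydisc R" if "cmod w \<le> 1" for w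
  proof -
    have "r * cmod w < R" using mult_left_mono[OF that, of r] r by linarith
    then show ?thesis using pw_le[OF that] by (auto simp: polydisc_def intro: le_less_trans)
  qed
  have dh: "\<exists>d. (h has_field_derivative d) (at w)" if "cmod w \<le> 1" for w
    unfolding h_def
  proof (rule holomorphic_several_curve[where p = p, OF hol p_in[OF that]])
    show "((\<lambda>w. p w $ i) has_field_derivative (\<chi> i. of_real r * (of_nat (k i) * w ^ (k i - 1))) $ i) (at w)" for i
      by (auto simp: p_def intro!: derivative_eq_intros)
  qed
  have holh: "h holomorphic_on ball 0 1"
    unfolding holomorphic_on_def using dh
    by (meson field_differentiable_at_within field_differentiable_def less_imp_le mem_ball_0)
  have conth: "continuous_on (cball 0 1) h"
    using dh by (intro continuous_at_imp_continuous_on) (use dh DERIV_isCont in fastforce)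
  have cauchy: "cmod ((deriv ^^ n) h 0) \<le> fact n * B / 1 ^ n" for n
    by (rule Cauchy_inequality[OF holh conth]) (auto simp: h_def intro!: B p_in)
  obtain \<rho> where \<rho>: "\<rho> > 0"
    "\<And>z. z \<in> polydisc \<rho> \<Longrightarrow> ((\<lambda>\<alpha>. c \<alpha> * (\<Prod>i\<in>UNIV. (z $ i) ^ \<alpha> i)) has_sum g z) UNIV"
    using exp unfolding has_mps_expansion_def by blast
  \<comment> \<open>Along the curve the monomial with exponent \<open>\<delta>\<close> becomes a
    power of \<open>r\<close> times \<open>w ^ \<kappa> \<delta>\<close>; \<open>d\<close> absorbs
    the power of \<open>r\<close>, and \<open>F\<close> collects equal powers of
    \<open>w\<close>.\<close>
  define d where "d \<delta> = c \<delta> * of_real r ^ (\<Sum>i\<in>UNIV. \<delta> i)" for \<delta> :: "'n \<Rightarrow> nat"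
  define F where "F = Abs_fps (\<lambda>n. \<Sum>\<delta> | \<kappa> \<delta> = n. d \<delta>)"
  have fin: "finite {\<delta>. \<kappa> \<delta> = n}" for n
  proof (rule finite_subset)
    have "\<delta> i \<le> \<kappa> \<delta>" for \<delta> i
    proof -
      have "\<delta> i \<le> k i * \<delta> i" using k[of i] by simp
      also have "\<dots> \<le> \<kappa> \<delta>" unfolding \<kappa>_def by (rule member_le_sum) auto
      finally show ?thesis .
    qed
    then show "{\<delta>. \<kappa> \<delta> = n} \<subseteq> PiE UNIV (\<lambda>_. {..n})" by auto
    show "finite (PiE (UNIV :: 'n set) (\<lambda>_. {..n}))" by (intro finite_PiE) auto
  qed
  \<comment> \<open>The expansion is known only near the origin, which suffices to identify Taylor
    coefficients. Unconditional summability allows the terms to be grouped by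
    \<open>\<kappa>\<close> into finite groups.\<close>
  have sums: "(\<lambda>n. fps_nth F n * w ^ n) sums h w" if w: "cmod w < min 1 (\<rho> / r)" for w
  proof -
    have "r * cmod w < \<rho>" using w r by (simp add: field_simps)
    then have "p w \<in> polydisc \<rho>"
      using pw_le[of w] w by (auto simp: polydisc_def intro: le_less_trans)
    then have "((\<lambda>\<delta>. c \<delta> * (\<Prod>i\<in>UNIV. (p w $ i) ^ \<delta> i)) has_sum h w) UNIV"
      unfolding h_def by (rule \<rho>)
    moreover have "c \<delta> * (\<Prod>i\<in>UNIV. (p w $ i) ^ \<delta> i) = d \<delta> * w ^ \<kappa> \<delta>" for \<delta>
      by (simp add: p_def d_def \<kappa>_def power_mult_distrib prod.distrib power_sum flip: power_mult)
    ultimately have s: "((\<lambda>\<delta>. d \<delta> * w ^ \<kappa> \<delta>) has_sum h w) UNIV" by simp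
    have bij: "bij_betw (\<lambda>(n, \<delta>). \<delta>) (SIGMA n:UNIV. {\<delta>. \<kappa> \<delta> = n}) UNIV"
      by (rule bij_betwI[where g = "\<lambda>\<delta>. (\<kappa> \<delta>, \<delta>)"]) auto
    have "((\<lambda>(n, \<delta>). d \<delta> * w ^ n) has_sum h w) (SIGMA n:UNIV. {\<delta>. \<kappa> \<delta> = n})"
      using s unfolding has_sum_reindex_bij_betw[OF bij, symmetric]
      by (rule has_sum_cong[THEN iffD1, rotated]) auto
    then have "((\<lambda>n. fps_nth F n * w ^ n) has_sum h w) UNIV"
      by (rule has_sum_SigmaD)
        (auto simp: F_def sum_distrib_right intro!: has_sum_finiteI fin)
    then show ?thesis by (rule has_sum_imp_sums)
  qed
  have "eventually (\<lambda>w. w \<in> ball 0 (min 1 (\<rho> / r))) (nhds (0::complex))"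
    using \<rho>(1) r by (intro eventually_nhds_in_open) auto
  then have "eventually (\<lambda>w. (\<lambda>n. fps_nth F n * w ^ n) sums h w) (nhds 0)"
    by eventually_elim (use sums in simp)
  then have "h has_fps_expansion F" by (rule has_fps_expansionI)
  then have "fps_nth F n = (deriv ^^ n) h 0 / fact n" for n
    by (rule fps_nth_fps_expansion)
  then have "cmod (fps_nth F n) \<le> B" for n
    using cauchy[of n] by (simp add: norm_divide divide_le_eq mult.commute)
  \<comment> \<open>Isolation: no other multi-index contributes to this Taylor coefficient of
    \<open>h\<close>.\<close>
  moreover have "{\<delta>. \<kappa> \<delta> = \<kappa> \<gamma>} = {\<gamma>}" using uniq by (auto simp: \<kappa>_def)
  then have "fps_nth F (\<kappa> \<gamma>) = d \<gamma>" by (simp add: F_def)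
  ultimately have "cmod (d \<gamma>) \<le> B" by metis
  then show ?thesis using r by (simp add: d_def norm_mult norm_power)
qed

section \<open>Convergence and holomorphy from geometric coefficient bounds\<close>

lemma summable_on_geometric_multi:
  fixes q :: real
  assumes "0 \<le> q" "q < 1"
  shows "(\<lambda>\<gamma> :: 'n::finite \<Rightarrow> nat. q ^ (\<Sum>i\<in>UNIV. \<gamma> i)) summable_on UNIV"
proof (rule nonneg_bdd_above_summable_on)
  show "bdd_above (sum (\<lambda>\<gamma> :: 'n \<Rightarrow> nat. q ^ (\<Sum>i\<in>UNIV. \<gamma> i)) ` {F. F \<subseteq> UNIV \<and> finite F})"
  proof (rule bdd_aboveI2)
    fix F :: "('n \<Rightarrow> nat) set" assume "F \<in> {F. F \<subseteq> UNIV \<and> finite F}"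
    then have F: "finite F" by simp
    define m where "m = (\<Sum>\<gamma>\<in>F. \<Sum>i\<in>UNIV. \<gamma> i)"
    have "\<gamma> i \<le> m" if "\<gamma> \<in> F" for \<gamma> i
    proof -
      have "\<gamma> i \<le> (\<Sum>i\<in>UNIV. \<gamma> i)" by (rule member_le_sum) auto
      also have "\<dots> \<le> m" unfolding m_def by (rule member_le_sum) (use F that in auto)
      finally show ?thesis .
    qed
    \<comment> \<open>Every finite set of multi-indices lies in a box, over which the sum factors
      into one-variable geometric sums.\<close>
    then have "F \<subseteq> PiE UNIV (\<lambda>_. {..m})" by auto
    then have "(\<Sum>\<gamma>\<in>F. q ^ (\<Sum>i\<in>UNIV. \<gamma> i)) \<le> (\<Sum>\<gamma>\<in>PiE (UNIV :: 'n set) (\<lambda>_. {..m}). q ^ (\<Sum>i\<in>UNIV. \<gamma> i))"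
      using assms by (intro sum_mono2[OF finite_PiE]) auto
    also have "\<dots> = (\<Prod>i\<in>(UNIV :: 'n set). \<Sum>k\<le>m. q ^ k)"
      by (subst prod_sum_PiE) (simp_all add: power_sum)
    also have "\<dots> \<le> (\<Prod>i\<in>(UNIV :: 'n set). 1 / (1 - q))"
    proof (intro prod_mono conjI)
      have "(\<Sum>k<Suc m. q ^ k) \<le> (\<Sum>k. q ^ k)"
        using assms by (intro sum_le_suminf summable_geometric) auto
      then show "(\<Sum>k\<le>m. q ^ k) \<le> 1 / (1 - q)"
        using assms by (simp only: lessThan_Suc_atMost) (simp add: suminf_geometric)
    qed (use assms in \<open>auto intro: sum_nonneg\<close>)
    finally show "(\<Sum>\<gamma>\<in>F. q ^ (\<Sum>i\<in>UNIV. \<gamma> i)) \<le> (\<Prod>i\<in>(UNIV :: 'n set). 1 / (1 - q))" .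
  qed
qed (use assms in simp)

lemma polydisc_eq_INT: "polydisc r = (\<Inter>i. (\<lambda>z. z $ i) -` ball 0 r)"
  by (auto simp: polydisc_def)

lemma open_polydisc: "open (polydisc r :: (complex ^ 'n::finite) set)"
  unfolding polydisc_eq_INT
  by (intro open_INT ballI open_vimage continuous_on_component) auto

lemma convex_polydisc: "convex (polydisc r :: (complex ^ 'n::finite) set)"
  unfolding polydisc_eq_INT
  by (intro convex_INT convex_linear_vimage) (auto intro: linearI)

lemma norm_monomial_le:
  fixes z :: "complex ^ 'n::finite"
  assumes "z \<in> polydisc r"
  shows "cmod (\<Prod>i\<in>A. (z $ i) ^ \<gamma> i) \<le> r ^ (\<Sum>i\<in>A. \<gamma> i)"
proof -
  have "cmod (\<Prod>i\<in>A. (z $ i) ^ \<gamma> i) = (\<Prod>i\<in>A. cmod (z $ i) ^ \<gamma> i)"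
    by (simp add: norm_power flip: prod_norm)
  also have "\<dots> \<le> (\<Prod>i\<in>A. r ^ \<gamma> i)"
    using assms by (intro prod_mono conjI power_mono) (auto simp: polydisc_def intro: less_imp_le)
  finally show ?thesis by (simp add: power_sum)
qed

context
  fixes c :: "('n::finite \<Rightarrow> nat) \<Rightarrow> complex" and C G r :: real
  assumes c: "\<And>\<gamma>. cmod (c \<gamma>) \<le> C * G ^ (\<Sum>i\<in>UNIV. \<gamma> i)"
    and r: "0 < r" and G: "0 < G" and Gr: "4 * G * r \<le> 1"
begin

text \<open>The differential of the term with exponent \<open>\<gamma>\<close> at \<open>z\<close>
  in direction \<open>h\<close>. For \<open>\<gamma> i = 0\<close> the truncated exponent
  \<open>\<gamma> i - 1\<close> is harmless, since the factor \<open>of_nat (\<gamma> i)\<close>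
  vanishes.\<close>

private definition mono_deriv :: "('n \<Rightarrow> nat) \<Rightarrow> complex ^ 'n \<Rightarrow> complex ^ 'n \<Rightarrow> complex" where
  "mono_deriv \<gamma> z h = c \<gamma> *
     (\<Sum>i\<in>UNIV. of_nat (\<gamma> i) * (z $ i) ^ (\<gamma> i - 1) * h $ i * (\<Prod>j\<in>UNIV - {i}. (z $ j) ^ \<gamma> j))"

private lemma C_nonneg: "0 \<le> C"
  using order_trans[OF norm_ge_zero c[of "\<lambda>_. 0"]] by simp

private lemma norm_mps_term_le:
  assumes "z \<in> polydisc r"
  shows "cmod (c \<gamma> * (\<Prod>i\<in>UNIV. (z $ i) ^ \<gamma> i)) \<le> C * (1 / 4) ^ (\<Sum>i\<in>UNIV. \<gamma> i)"
proof -
  let ?n = "\<Sum>i\<in>UNIV. \<gamma> i"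
  have "cmod (c \<gamma> * (\<Prod>i\<in>UNIV. (z $ i) ^ \<gamma> i)) \<le> (C * G ^ ?n) * r ^ ?n"
    unfolding norm_mult using C_nonneg G by (intro mult_mono c norm_monomial_le assms) auto
  also have "\<dots> = C * (G * r) ^ ?n" by (simp add: power_mult_distrib)
  also have "\<dots> \<le> C * (1 / 4) ^ ?n"
    using C_nonneg G r Gr by (intro mult_left_mono power_mono) auto
  finally show ?thesis .
qed

lemma mps_summable:
  assumes "z \<in> polydisc r"
  shows "(\<lambda>\<gamma>. cmod (c \<gamma> * (\<Prod>i\<in>UNIV. (z $ i) ^ \<gamma> i))) summable_on UNIV"
  by (rule Infinite_Sum.abs_summable_on_comparison_test'[OF _ norm_mps_term_le[OF assms]])
    (intro summable_on_cmult_right summable_on_geometric_multi, auto)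

lemma norm_mps_le:
  assumes "z \<in> polydisc r"
  shows "cmod (\<Sum>\<^sub>\<infinity>\<gamma>. c \<gamma> * (\<Prod>i\<in>UNIV. (z $ i) ^ \<gamma> i)) \<le> C * (\<Sum>\<^sub>\<infinity>\<gamma> :: 'n \<Rightarrow> nat. (1 / 4) ^ (\<Sum>i\<in>UNIV. \<gamma> i))"
proof -
  have "cmod (\<Sum>\<^sub>\<infinity>\<gamma>. c \<gamma> * (\<Prod>i\<in>UNIV. (z $ i) ^ \<gamma> i)) \<le> (\<Sum>\<^sub>\<infinity>\<gamma> :: 'n \<Rightarrow> nat. C * (1 / 4) ^ (\<Sum>i\<in>UNIV. \<gamma> i))"
    by (rule norm_infsum_le[OF _ _ norm_mps_term_le[OF assms]])
      (auto intro!: has_sum_infsum abs_summable_summable[OF mps_summable[OF assms]]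
        summable_on_cmult_right summable_on_geometric_multi)
  then show ?thesis by (simp add: infsum_cmult_right')
qed

text \<open>Differentiating costs the total degree divided by \<open>r\<close>. The degree is below
  2 to its own power, and \<open>4 * G * r \<le> 1\<close> leaves
  \<open>2 * G * r \<le> 1 / 2\<close>, so the differentials still decay geometrically, uniformly in
  \<open>z\<close>.\<close>

private lemma norm_mono_deriv_le:
  assumes z: "z \<in> polydisc r"
  shows "cmod (mono_deriv \<gamma> z h) \<le> C / r * (1 / 2) ^ (\<Sum>i\<in>UNIV. \<gamma> i) * norm h"
proof -
  let ?n = "\<Sum>i\<in>UNIV. \<gamma> i"
  have term_le: "cmod (of_nat (\<gamma> i) * (z $ i) ^ (\<gamma> i - 1) * h $ i * (\<Prod>j\<in>UNIV - {i}. (z $ j) ^ \<gamma> j))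
      \<le> real (\<gamma> i) * (r ^ ?n / r * norm h)" for i
  proof (cases "\<gamma> i = 0")
    case False
    have "cmod (z $ i) ^ (\<gamma> i - 1) \<le> r ^ (\<gamma> i - 1)"
      using z by (intro power_mono) (auto simp: polydisc_def less_imp_le)
    then have "cmod (of_nat (\<gamma> i) * (z $ i) ^ (\<gamma> i - 1) * h $ i * (\<Prod>j\<in>UNIV - {i}. (z $ j) ^ \<gamma> j))
        \<le> real (\<gamma> i) * r ^ (\<gamma> i - 1) * norm h * r ^ (\<Sum>j\<in>UNIV - {i}. \<gamma> j)"
      unfolding norm_mult norm_power norm_of_nat using r
      by (intro mult_mono norm_monomial_le[OF z]) (auto intro!: mult_nonneg_nonneg Finite_Cartesian_Product.norm_nth_le)
    moreover have "?n = Suc (\<gamma> i - 1) + (\<Sum>j\<in>UNIV - {i}. \<gamma> j)"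
      using False by (subst sum.remove[of _ i]) auto
    then have "r ^ ?n / r = r ^ (\<gamma> i - 1) * r ^ (\<Sum>j\<in>UNIV - {i}. \<gamma> j)"
      using r by (simp add: power_add)
    ultimately show ?thesis by (simp add: mult_ac)
  qed simp
  have "cmod (mono_deriv \<gamma> z h) \<le> (C * G ^ ?n) * (\<Sum>i\<in>UNIV. real (\<gamma> i) * (r ^ ?n / r * norm h))"
    unfolding mono_deriv_def norm_mult using C_nonneg G
    by (intro mult_mono c sum_norm_le term_le) auto
  also have "\<dots> = (C * G ^ ?n) * (real ?n * (r ^ ?n / r * norm h))"
    by (simp only: of_nat_sum sum_distrib_right)
  also have "\<dots> \<le> (C * G ^ ?n) * (2 ^ ?n * (r ^ ?n / r * norm h))"
    using C_nonneg G r less_imp_le[OF of_nat_less_two_power[of ?n, where ?'a = real]]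
    by (intro mult_left_mono mult_right_mono) auto
  also have "\<dots> = C / r * (2 * G * r) ^ ?n * norm h"
    by (simp add: power_mult_distrib)
  also have "\<dots> \<le> C / r * (1 / 2) ^ ?n * norm h"
    using C_nonneg G r Gr by (intro mult_left_mono mult_right_mono power_mono) auto
  finally show ?thesis .
qed

private lemma mono_deriv_cmult: "mono_deriv \<gamma> z (a *s h) = a * mono_deriv \<gamma> z h"
  by (simp add: mono_deriv_def sum_distrib_left mult_ac)

private lemma has_derivative_mono_deriv:
  "((\<lambda>z. c \<gamma> * (\<Prod>i\<in>UNIV. (z $ i) ^ \<gamma> i)) has_derivative mono_deriv \<gamma> z) (at z within S)"
proof -
  have "((\<lambda>z. (z $ i) ^ \<gamma> i) has_derivative (\<lambda>h. of_nat (\<gamma> i) * (h $ i) * (z $ i) ^ (\<gamma> i - 1))) (at z within S)" for i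
    by (rule has_derivative_power[OF bounded_linear.has_derivative[OF bounded_linear_vec_nth has_derivative_ident]])
  then show ?thesis
    by (rule has_derivative_eq_rhs[OF has_derivative_mult_right[OF has_derivative_prod]])
      (simp add: mono_deriv_def fun_eq_iff mult_ac)
qed

text \<open>Termwise differentiation: the differentials have a summable majorant that does not
  depend on \<open>z\<close>, and the complex linearity of each of them passes to the sum.\<close>

lemma mps_holomorphic:
  "holomorphic_several (\<lambda>z. \<Sum>\<^sub>\<infinity>\<gamma>. c \<gamma> * (\<Prod>i\<in>UNIV. (z $ i) ^ \<gamma> i)) (polydisc r)"
proof -
  define g where "g z = (\<Sum>\<^sub>\<infinity>\<gamma>. c \<gamma> * (\<Prod>i\<in>UNIV. (z $ i) ^ \<gamma> i))" for z :: "complex ^ 'n"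
  \<comment> \<open>An enumeration of the countably infinite set of multi-indices turns the
    unordered sum into a series, to which \<open>has_derivative_series\<close> applies.\<close>
  have "inj (\<lambda>k::nat. (\<lambda>_::'n. k))" by (auto simp: inj_def fun_eq_iff)
  then have "infinite (UNIV :: ('n \<Rightarrow> nat) set)"
    by (meson finite_imageD infinite_UNIV_nat finite_subset subset_UNIV)
  then have e: "bij_betw (from_nat_into UNIV) UNIV (UNIV :: ('n \<Rightarrow> nat) set)" (is "bij_betw ?e _ _")
    by (rule bij_betw_from_nat_into[rotated]) auto
  define b where "b n = C / r * (1 / 2) ^ (\<Sum>i\<in>UNIV. ?e n i)" for n
  have "(\<lambda>\<gamma> :: 'n \<Rightarrow> nat. C / r * (1 / 2) ^ (\<Sum>i\<in>UNIV. \<gamma> i)) summable_on UNIV"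
    by (intro summable_on_cmult_right summable_on_geometric_multi) auto
  then have b: "summable b"
    unfolding b_def summable_on_reindex_bij_betw[OF e, symmetric] by (rule summable_on_imp_summable)
  have b0: "b n \<ge> 0" for n using C_nonneg r by (simp add: b_def)
  have le: "norm (mono_deriv (?e n) z h) \<le> b n * norm h" if "z \<in> polydisc r" for n z h
    using norm_mono_deriv_le[OF that] by (simp add: b_def)
  have sd: "summable (\<lambda>n. norm (mono_deriv (?e n) z h))" if "z \<in> polydisc r" for z h
    by (rule summable_comparison_test'[where N = 0, OF summable_mult2[OF b, of "norm h"]]) (use le[OF that] in simp)
  define g' where "g' z h = (\<Sum>n. mono_deriv (?e n) z h)" for z h
  have sums: "(\<lambda>n. c (?e n) * (\<Prod>i\<in>UNIV. (z $ i) ^ ?e n i)) sums g z" if "z \<in> polydisc r" for z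
    using abs_summable_summable[OF mps_summable[OF that]] unfolding g_def
    by (intro has_sum_imp_sums has_sum_reindex_bij_betw[OF e, THEN iffD2] has_sum_infsum)
  have 0: "(0 :: complex ^ 'n) \<in> polydisc r" using r by (simp add: polydisc_def)
  have "\<exists>g2. \<forall>z\<in>(polydisc r :: (complex ^ 'n) set). (\<lambda>n. c (?e n) * (\<Prod>i\<in>UNIV. (z $ i) ^ ?e n i)) sums g2 z \<and>
      (g2 has_derivative g' z) (at z within polydisc r)"
  proof (rule has_derivative_series[OF convex_polydisc has_derivative_mono_deriv _ 0 sums[OF 0]])
    fix \<epsilon> :: real assume "\<epsilon> > 0"
    obtain N where N: "\<And>n. n \<ge> N \<Longrightarrow> norm (\<Sum>i. b (i + n)) < \<epsilon>"
      using suminf_exist_split[OF \<open>\<epsilon> > 0\<close> b] by blast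
    show "\<forall>\<^sub>F n in sequentially. \<forall>z\<in>(polydisc r :: (complex ^ 'n) set). \<forall>h.
        cmod ((\<Sum>i<n. mono_deriv (?e i) z h) - g' z h) \<le> \<epsilon> * norm h"
      unfolding eventually_sequentially
    proof (intro exI[of _ N] allI impI ballI)
      fix n and z h :: "complex ^ 'n" assume n: "N \<le> n" and z: "z \<in> polydisc r"
      have "g' z h - (\<Sum>i<n. mono_deriv (?e i) z h) = (\<Sum>i. mono_deriv (?e (i + n)) z h)"
        unfolding g'_def
        using suminf_minus_initial_segment[OF summable_norm_cancel[OF sd[OF z, of h]], of n] by simp
      then have "cmod ((\<Sum>i<n. mono_deriv (?e i) z h) - g' z h) = cmod (\<Sum>i. mono_deriv (?e (i + n)) z h)"
        by (metis norm_minus_commute)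
      also have "\<dots> \<le> (\<Sum>i. b (i + n) * norm h)"
        by (rule norm_suminf_le) (use le[OF z] b in \<open>auto intro!: summable_mult2 simp: summable_iff_shift\<close>)
      also have "\<dots> = (\<Sum>i. b (i + n)) * norm h"
        by (rule suminf_mult2[symmetric]) (simp add: summable_iff_shift b)
      also have "\<dots> \<le> \<epsilon> * norm h"
        using N[OF n] by (intro mult_right_mono) auto
      finally show "cmod ((\<Sum>i<n. mono_deriv (?e i) z h) - g' z h) \<le> \<epsilon> * norm h" .
    qed
  qed
  then obtain g2 where g2: "\<And>z. z \<in> polydisc r \<Longrightarrow> (\<lambda>n. c (?e n) * (\<Prod>i\<in>UNIV. (z $ i) ^ ?e n i)) sums g2 z"
      "\<And>z. z \<in> polydisc r \<Longrightarrow> (g2 has_derivative g' z) (at z within polydisc r)"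
    by blast
  show ?thesis
    unfolding holomorphic_several_def g_def[symmetric]
  proof (intro ballI exI conjI allI)
    fix z :: "complex ^ 'n" assume z: "z \<in> polydisc r"
    \<comment> \<open>\<open>g2\<close> is only known to exist, but on the polydisc it is the sum of
      the same series as \<open>g\<close>.\<close>
    have "(g has_derivative g' z) (at z within polydisc r)"
      by (rule has_derivative_transform[OF z _ g2(2)[OF z]]) (use sums g2(1) sums_unique2 in blast)
    then show "(g has_derivative g' z) (at z)"
      using at_within_open[OF z open_polydisc] by simp
    show "g' z (a *s v) = a * g' z v" for a v
      unfolding g'_def mono_deriv_cmult
      by (rule suminf_mult) (rule summable_norm_cancel[OF sd[OF z]])
  qed
qed

end

text \<open>Used to bound the initial data: the closed polydisc of radius \<open>r\<close> is
  compact and, since \<open>r < R\<close>, lies where \<open>g\<close> is continuous.\<close>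

lemma holomorphic_several_bounded:
  fixes g :: "complex ^ 'n::finite \<Rightarrow> complex"
  assumes "holomorphic_several g (polydisc R)" "r < R"
  obtains b where "b > 0" "\<And>z. z \<in> polydisc r \<Longrightarrow> cmod (g z) \<le> b"
proof -
  define P :: "(complex ^ 'n) set" where "P = (\<Inter>i. (\<lambda>z. z $ i) -` cball 0 r)"
  have "closed P" unfolding P_def
    by (intro closed_INT ballI closed_vimage continuous_on_component) auto
  moreover have "bounded P"
  proof (rule boundedI)
    fix z assume "z \<in> P"
    then have "cmod (z $ i) \<le> r" for i by (auto simp: P_def)
    then have "(\<Sum>i\<in>UNIV. cmod (z $ i)) \<le> (\<Sum>i\<in>(UNIV :: 'n set). r)" by (rule sum_mono)
    then show "norm z \<le> (\<Sum>i\<in>(UNIV :: 'n set). r)"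
      using L2_set_le_sum[of UNIV "\<lambda>i. cmod (z $ i)"] by (simp add: norm_vec_def)
  qed
  ultimately have "compact P" by (simp add: compact_eq_bounded_closed)
  moreover have "continuous_on P g"
  proof (rule continuous_at_imp_continuous_on, rule ballI)
    fix z assume "z \<in> P"
    then have "cmod (z $ i) < R" for i using assms(2) by (auto simp: P_def intro: le_less_trans[of _ r])
    then obtain D where "(g has_derivative D) (at z)"
      using assms(1) unfolding holomorphic_several_def polydisc_def by blast
    then show "isCont g z" by (rule has_derivative_continuous)
  qed
  ultimately have "bounded (g ` P)" by (intro compact_imp_bounded compact_continuous_image)
  then obtain b where "b > 0" "\<And>z. z \<in> P \<Longrightarrow> cmod (g z) \<le> b"
    unfolding bounded_pos by blast
  moreover have "polydisc r \<subseteq> P" by (auto simp: P_def polydisc_def less_imp_le)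
  ultimately show ?thesis using that by blast
qed

lemma polydisc_mono: "r \<le> r' \<Longrightarrow> polydisc r \<subseteq> polydisc r'"
  by (auto simp: polydisc_def intro: less_le_trans[of _ r])

lemma holomorphic_several_subset:
  "holomorphic_several g S \<Longrightarrow> T \<subseteq> S \<Longrightarrow> holomorphic_several g T"
  unfolding holomorphic_several_def by blast

text \<open>The growth rate \<open>G\<close> in \<open>\<gamma>\<close> does not depend on
  \<open>n\<close>, so a single polydisc serves all coefficient functions; summing over
  \<open>\<gamma>\<close> changes only the constant.\<close>

lemma gevrey_holomorphic_of_coefficients:
  fixes u :: "nat \<Rightarrow> ('n::finite \<Rightarrow> nat) \<Rightarrow> complex"
  assumes u: "\<And>n \<gamma>. cmod (u n \<gamma>) \<le> C * H ^ n * M n powr \<kappa> * G ^ (\<Sum>i\<in>UNIV. \<gamma> i)"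
    and pos: "C > 0" "H > 0" "G > 0" "R > 0"
  shows "\<exists>r U. 0 < r \<and> r < R \<and> (\<forall>n. has_mps_expansion (U n) (u n)) \<and> U \<in> gevrey_holomorphic r M \<kappa>"
proof -
  \<comment> \<open>\<open>R / 2\<close> ensures \<open>r < R\<close>; \<open>1 / (4 * G)\<close> is
    the radius that the convergence lemmas allow.\<close>
  define r where "r = min (R / 2) (1 / (4 * G))"
  have r: "0 < r" "r < R" using pos by (simp_all add: r_def min_less_iff_disj)
  have "4 * G * r \<le> 4 * G * (1 / (4 * G))" using pos by (intro mult_left_mono) (simp_all add: r_def)
  then have Gr: "4 * G * r \<le> 1" using pos by simp
  define U where "U n z = (\<Sum>\<^sub>\<infinity>\<gamma>. u n \<gamma> * (\<Prod>i\<in>UNIV. (z $ i) ^ \<gamma> i))" for n and z :: "complex ^ 'n"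
  define S where "S = (\<Sum>\<^sub>\<infinity>\<gamma> :: 'n \<Rightarrow> nat. (1 / 4 :: real) ^ (\<Sum>i\<in>UNIV. \<gamma> i))"
  have S: "S \<ge> 0" unfolding S_def by (rule infsum_nonneg) simp
  have "has_mps_expansion (U n) (u n)" for n
    unfolding has_mps_expansion_def
  proof (intro exI[of _ r] conjI ballI r(1))
    fix z :: "complex ^ 'n" assume "z \<in> polydisc r"
    then show "((\<lambda>\<alpha>. u n \<alpha> * (\<Prod>i\<in>UNIV. (z $ i) ^ \<alpha> i)) has_sum U n z) UNIV"
      unfolding U_def
      by (rule has_sum_infsum[OF abs_summable_summable[OF mps_summable[where c = "u n", OF u[of n] r(1) pos(3) Gr]]])
  qed
  moreover have "U \<in> gevrey_holomorphic r M \<kappa>"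
    unfolding gevrey_holomorphic_def
  proof (intro CollectI conjI allI impI)
    show "holomorphic_several (U n) (polydisc r)" for n
      using mps_holomorphic[where c = "u n", OF u[of n] r(1) pos(3) Gr] unfolding U_def .
    fix r' assume r': "0 < r' \<and> r' < r"
    show "\<exists>A>0. \<exists>B>0. \<forall>z\<in>polydisc r'. \<forall>n. cmod (U n z) \<le> A * B ^ n * M n powr \<kappa>"
    \<comment> \<open>\<open>S + 1\<close> instead of \<open>S\<close> makes the constant
      positive.\<close>
    proof (rule exI[of _ "C * (S + 1)"], intro exI[of _ H] conjI ballI allI)
      fix z :: "complex ^ 'n" and n assume "z \<in> polydisc r'"
      then have "z \<in> polydisc r" using r' polydisc_mono[of r' r] by auto
      then have "cmod (U n z) \<le> C * H ^ n * M n powr \<kappa> * S"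
        unfolding U_def S_def by (rule norm_mps_le[where c = "u n", OF u[of n] r(1) pos(3) Gr])
      also have "\<dots> \<le> C * H ^ n * M n powr \<kappa> * (S + 1)"
        using pos by (intro mult_left_mono) auto
      finally show "cmod (U n z) \<le> C * (S + 1) * H ^ n * M n powr \<kappa>" by (simp add: mult_ac)
    qed (use pos S in auto)
  qed
  ultimately show ?thesis by (intro exI[of _ r] exI[of _ U] conjI allI r)
qed

section \<open>Weight sequences\<close>

text \<open>Enlarging the constant preserves the inequality, and with \<open>B \<ge> 1\<close> its
  powers can be compared by their exponents.\<close>

lemma moderate_growth_ge_1:
  assumes "moderate_growth M" and M1: "incseq M" "M 0 = 1"
  obtains B where "B \<ge> 1" "\<And>n k. M (n + k) \<le> B ^ (n + k) * M n * M k"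
proof -
  obtain B where B: "B > 0" "\<And>n k. M (n + k) \<le> B ^ (n + k) * M n * M k"
    using assms(1) unfolding moderate_growth_def by blast
  have "M n \<ge> 1" for n using incseqD[OF M1(1), of 0 n] M1(2) by simp
  then have nn: "M n \<ge> 0" for n using order_trans[OF zero_le_one] by blast
  show ?thesis
  proof (rule that[of "max 1 B"])
    fix n k
    have "B ^ (n + k) \<le> max 1 B ^ (n + k)" using B(1) by (intro power_mono) auto
    then have "B ^ (n + k) * M n * M k \<le> max 1 B ^ (n + k) * M n * M k"
      by (intro mult_right_mono nn) auto
    with B(2)[of n k] show "M (n + k) \<le> max 1 B ^ (n + k) * M n * M k" by linarith
  qed simp
qed

locale weight_sequence =
  fixes M :: "nat \<Rightarrow> real" and B :: real
  assumes inc: "incseq M" and M0: "M 0 = 1" and lc: "log_convex_seq M"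
    and B: "B \<ge> 1" and mg: "M (n + k) \<le> B ^ (n + k) * M n * M k"
begin

definition ratio :: "nat \<Rightarrow> real" where
  "ratio n = M (Suc n) / M n"

lemma M_ge_1: "M n \<ge> 1"
  using incseqD[OF inc, of 0 n] M0 by simp

lemma M_pos: "M n > 0"
  using M_ge_1[of n] by linarith

lemma M_Suc: "M (Suc n) = M n * ratio n"
  using M_pos[of n] by (simp add: ratio_def)

lemma ratio_ge_1: "ratio n \<ge> 1"
  using incseqD[OF inc, of n "Suc n"] M_pos[of n] by (simp add: ratio_def)

lemma ratio_pos: "ratio n > 0"
  using ratio_ge_1[of n] by linarith

lemma incseq_ratio: "incseq ratio"
proof (rule incseq_SucI)
  fix n
  have "(M (Suc n))\<^sup>2 \<le> M n * M (Suc (Suc n))"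
    using lc unfolding log_convex_seq_def by (metis Suc_eq_plus1 diff_Suc_1 le_add2)
  then show "ratio n \<le> ratio (Suc n)"
    using M_pos[of n] M_pos[of "Suc n"] by (simp add: ratio_def field_simps power2_eq_square)
qed

text \<open>\<open>M (n + k) / M n\<close> is a product of \<open>k\<close> successive ratios whose
  indices do not exceed \<open>N\<close>; by log-convexity each is at most
  \<open>ratio N\<close>.\<close>

lemma M_add_le:
  assumes "n + k \<le> Suc N"
  shows "M (n + k) \<le> M n * ratio N ^ k"
  using assms
proof (induction k)
  case (Suc k)
  have "M (n + Suc k) = M (n + k) * ratio (n + k)" by (simp add: M_Suc)
  also have "\<dots> \<le> (M n * ratio N ^ k) * ratio N"
    using Suc M_pos ratio_pos by (intro mult_mono incseqD[OF incseq_ratio]) (auto intro: less_imp_le mult_nonneg_nonneg)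
  finally show ?case by (simp add: mult_ac)
qed simp

lemma M_le_ratio_power: "n \<le> Suc N \<Longrightarrow> M n \<le> ratio N ^ n"
  using M_add_le[of 0 n N] by (simp add: M0)

lemma M_add_ge: "M n * ratio n ^ k \<le> M (n + k)"
proof (induction k)
  case (Suc k)
  have "M n * ratio n ^ k * ratio n \<le> M (n + k) * ratio (n + k)"
    using Suc M_pos ratio_pos by (intro mult_mono incseqD[OF incseq_ratio]) (auto intro: less_imp_le)
  then show ?case by (simp add: M_Suc mult_ac)
qed simp

text \<open>A converse of \<open>M_le_ratio_power\<close> up to a geometric factor: the
  \<open>n\<close> ratios from index \<open>n\<close> onwards are at least \<open>ratio n\<close>,
  so \<open>M n * ratio n ^ n \<le> M (2 * n)\<close>, and moderate growth bounds the right side by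
  \<open>B ^ (2 * n) * M n * M n\<close>.\<close>

lemma ratio_power_le: "ratio n ^ n \<le> B ^ (2 * n) * M n"
proof -
  have "M n * ratio n ^ n \<le> M n * (B ^ (2 * n) * M n)"
    using M_add_ge[of n n] mg[of n n] by (simp add: mult_ac mult_2_right)
  then show ?thesis using M_pos[of n] by simp
qed

text \<open>Compare the powers with exponent \<open>2 * n\<close>: the two uses of moderate growth
  cost \<open>B ^ (4 * n) * B ^ (2 * n)\<close>, whose root is \<open>B ^ 3\<close>. For
  \<open>n = 0\<close> no root can be taken, but there both indices coincide.\<close>

lemma ratio_double_le: "ratio (2 * n) \<le> B ^ 3 * ratio n"
proof (cases "n = 0")
  case True
  have "1 * ratio 0 \<le> B ^ 3 * ratio 0"
    using B ratio_pos[of 0] by (intro mult_right_mono one_le_power) (auto intro: less_imp_le)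
  then show ?thesis using True by simp
next
  case False
  have "ratio (2 * n) ^ (2 * n) \<le> B ^ (4 * n) * M (2 * n)"
    using ratio_power_le[of "2 * n"] by simp
  also have "\<dots> \<le> B ^ (4 * n) * (B ^ (2 * n) * (ratio n ^ n * ratio n ^ n))"
  proof (rule mult_left_mono)
    have "M n * M n \<le> ratio n ^ n * ratio n ^ n"
      using M_le_ratio_power[of n n] M_pos[of n] by (intro mult_mono) auto
    then have "B ^ (2 * n) * (M n * M n) \<le> B ^ (2 * n) * (ratio n ^ n * ratio n ^ n)"
      using B by (intro mult_left_mono) auto
    then show "M (2 * n) \<le> B ^ (2 * n) * (ratio n ^ n * ratio n ^ n)"
      using mg[of n n] by (simp add: mult_2 mult.assoc)
  qed (use B in simp)
  also have "\<dots> = (B ^ 3 * ratio n) ^ (2 * n)"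
  proof -
    have "B ^ (4 * n) * B ^ (2 * n) = (B ^ 3) ^ (2 * n)"
      by (simp flip: power_mult power_add)
    then show ?thesis by (simp add: power_mult_distrib mult.assoc[symmetric] mult_2 power_add)
  qed
  finally show ?thesis
    using False B ratio_pos[of n] by (subst (asm) power_mono_iff) (auto intro: less_imp_le ratio_pos)
qed

lemma ratio_dyadic_le: "ratio (2 ^ d * n) \<le> (B ^ 3) ^ d * ratio n"
proof (induction d)
  case (Suc d)
  have "ratio (2 ^ Suc d * n) \<le> B ^ 3 * ratio (2 ^ d * n)"
    using ratio_double_le[of "2 ^ d * n"] by (simp add: mult_ac)
  also have "\<dots> \<le> B ^ 3 * ((B ^ 3) ^ d * ratio n)"
    using B by (intro mult_left_mono Suc) auto
  finally show ?case by (simp add: mult_ac)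
qed simp

lemma M_le_dyadic:
  assumes "l \<le> 2 ^ d * n"
  shows "M l \<le> ((B ^ 3) ^ d * ratio n) ^ l"
proof -
  have "M l \<le> ratio (2 ^ d * n) ^ l" using assms by (intro M_le_ratio_power) simp
  also have "\<dots> \<le> ((B ^ 3) ^ d * ratio n) ^ l"
    using ratio_pos by (intro power_mono ratio_dyadic_le) (auto intro: less_imp_le)
  finally show ?thesis .
qed

end

section \<open>Majorants for the Cauchy problem\<close>

text \<open>All exponents are positive because \<open>j < q + K\<close>, so one factor
  \<open>x\<close> can be taken out of a geometric sum that is at most 2. This smallness drives
  \<open>majorant_bound\<close>.\<close>

lemma sum_geometric_shift_le:
  fixes x :: real
  assumes "0 \<le> x" "x \<le> 1 / 2" and "j < q + K"
  shows "(\<Sum>k=q..n. x ^ (k + K - j)) \<le> 2 * x"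
proof -
  have "(\<Sum>k=q..n. x ^ (k + K - Suc j)) = (\<Sum>p\<in>(\<lambda>k. k + K - Suc j) ` {q..n}. x ^ p)"
    using assms(3) by (subst sum.reindex) (auto simp: inj_on_def)
  also have "\<dots> \<le> (\<Sum>p. x ^ p)"
    using assms by (intro sum_le_suminf summable_geometric) auto
  also have "\<dots> \<le> 2" using assms by (subst suminf_geometric) (auto simp: field_simps)
  finally have "x * (\<Sum>k=q..n. x ^ (k + K - Suc j)) \<le> x * 2"
    using assms by (intro mult_left_mono) auto
  moreover have "x ^ (k + K - j) = x * x ^ (k + K - Suc j)" if "k \<ge> q" for k
  proof -
    have "k + K - j = Suc (k + K - Suc j)" using that assms(3) by linarith
    then show ?thesis by simp
  qed
  ultimately show ?thesis by (simp add: sum_distrib_left)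
qed

text \<open>Induction on \<open>N\<close> for all \<open>\<beta>\<close> in a window. One use of the
  recursion lowers \<open>N\<close> by some \<open>p \<ge> 1\<close> and raises each
  \<open>\<beta> i\<close> by at most \<open>D\<close>, so the window
  \<open>\<beta> i \<le> D * (N0 - N)\<close> is never left. The exponents of \<open>L\<close> match
  exactly: \<open>\<tau> * p - s \<cdot> \<alpha>\<close> from the coefficient plus
  \<open>\<tau> * (N - p) + s \<cdot> (\<beta> + \<alpha>)\<close> from the earlier term give
  \<open>\<tau> * N + s \<cdot> \<beta>\<close>. The factor \<open>(Q / H) ^ p\<close> makes the
  recursive part small for large \<open>H\<close>.\<close>

lemma majorant_bound:
  fixes W S :: "nat \<Rightarrow> ('n::finite \<Rightarrow> nat) \<Rightarrow> real"
    and c :: "nat \<Rightarrow> ('n \<Rightarrow> nat) \<Rightarrow> nat \<Rightarrow> nat \<Rightarrow> real"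
    and s :: "'n \<Rightarrow> real"
  assumes rec: "\<And>n \<beta>. n + K \<le> N0 \<Longrightarrow> W (n + K) \<beta> \<le> S (n + K) \<beta> +
        (\<Sum>(j, \<alpha>)\<in>\<Lambda>. \<Sum>k=q j \<alpha>..n. c j \<alpha> n k * W (n - k + j) (\<lambda>i. \<beta> i + \<alpha> i))"
    and q: "\<And>j \<alpha>. (j, \<alpha>) \<in> \<Lambda> \<Longrightarrow> j < q j \<alpha> + K"
    and D: "\<And>j \<alpha> i. (j, \<alpha>) \<in> \<Lambda> \<Longrightarrow> \<alpha> i \<le> D"
    and c: "\<And>j \<alpha> n k. (j, \<alpha>) \<in> \<Lambda> \<Longrightarrow> q j \<alpha> \<le> k \<Longrightarrow> k \<le> n \<Longrightarrow> n + K \<le> N0 \<Longrightarrow>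
        0 \<le> c j \<alpha> n k \<and> c j \<alpha> n k \<le> A * Q ^ (k + K - j) * L powr (\<tau> * real (k + K - j) - (\<Sum>i\<in>UNIV. s i * \<alpha> i))"
    and W0: "\<And>N \<beta>. N < K \<Longrightarrow> N \<le> N0 \<Longrightarrow> (\<And>i. \<beta> i \<le> D * (N0 - N)) \<Longrightarrow>
        W N \<beta> \<le> C * H0 ^ N * G ^ (\<Sum>i\<in>UNIV. \<beta> i) * L powr (\<tau> * real N + (\<Sum>i\<in>UNIV. s i * \<beta> i))"
    and S0: "\<And>N \<beta>. K \<le> N \<Longrightarrow> N \<le> N0 \<Longrightarrow> (\<And>i. \<beta> i \<le> D * (N0 - N)) \<Longrightarrow>
        S N \<beta> \<le> C * H0 ^ N * G ^ (\<Sum>i\<in>UNIV. \<beta> i) * L powr (\<tau> * real N + (\<Sum>i\<in>UNIV. s i * \<beta> i))"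
    and pos: "0 \<le> C" "0 \<le> A" "0 \<le> Q" "0 < G" "0 < L" "0 \<le> H0" "0 < H"
    and H: "H0 \<le> H" "2 * Q \<le> H" "4 * Q * A * (\<Sum>(j, \<alpha>)\<in>\<Lambda>. G ^ (\<Sum>i\<in>UNIV. \<alpha> i)) \<le> H"
    and N: "N \<le> N0" "\<And>i. \<beta> i \<le> D * (N0 - N)"
  shows "W N \<beta> \<le> 2 * C * H ^ N * G ^ (\<Sum>i\<in>UNIV. \<beta> i) * L powr (\<tau> * real N + (\<Sum>i\<in>UNIV. s i * \<beta> i))"
  using N
proof (induction N arbitrary: \<beta> rule: less_induct)
  case (less N)
  define X where "X = G ^ (\<Sum>i\<in>UNIV. \<beta> i) * L powr (\<tau> * real N + (\<Sum>i\<in>UNIV. s i * \<beta> i))"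
  have X: "X \<ge> 0" using pos by (simp add: X_def)
  have H0: "C * H0 ^ N * X \<le> C * H ^ N * X"
    using pos H X by (intro mult_left_mono mult_right_mono power_mono) auto
  have CHX: "0 \<le> C * H ^ N * X" using pos X by simp
  show ?case
  proof (cases "N < K")
    case True
    then show ?thesis using W0[where N = N and \<beta> = \<beta>, OF True less.prems] H0 CHX by (simp add: X_def mult_ac)
  next
    case False
    define n where "n = N - K"
    have N: "N = n + K" using False by (simp add: n_def)
    \<comment> \<open>The factor gained per unit step down in \<open>N\<close>;
      \<open>2 * Q \<le> H\<close> brings it into the range of
      \<open>sum_geometric_shift_le\<close>.\<close>
    define x where "x = Q / H"
    have x: "0 \<le> x" "x \<le> 1 / 2" using pos H by (simp_all add: x_def field_simps)
    have "(\<Sum>k=q j \<alpha>..n. c j \<alpha> n k * W (n - k + j) (\<lambda>i. \<beta> i + \<alpha> i))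
        \<le> 2 * x * (A * G ^ (\<Sum>i\<in>UNIV. \<alpha> i)) * (2 * C * H ^ N * X)" if \<Lambda>: "(j, \<alpha>) \<in> \<Lambda>" for j \<alpha>
    proof -
      have "(\<Sum>k=q j \<alpha>..n. c j \<alpha> n k * W (n - k + j) (\<lambda>i. \<beta> i + \<alpha> i))
          \<le> (\<Sum>k=q j \<alpha>..n. x ^ (k + K - j) * ((A * G ^ (\<Sum>i\<in>UNIV. \<alpha> i)) * (2 * C * H ^ N * X)))"
      proof (rule sum_mono)
        fix k assume "k \<in> {q j \<alpha>..n}"
        then have k: "q j \<alpha> \<le> k" "k \<le> n" by auto
        define p where "p = k + K - j"
        define N' where "N' = n - k + j"
        have p: "p \<ge> 1" "N = N' + p" using q[OF \<Lambda>] k by (auto simp: p_def N'_def N)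
        have "\<beta> i + \<alpha> i \<le> D * (N0 - N')" for i
        proof -
          have "\<beta> i + \<alpha> i \<le> D * (N0 - N) + D" using less.prems(2)[of i] D[OF \<Lambda>, of i] by linarith
          also have "\<dots> = D * Suc (N0 - N)" by simp
          also have "\<dots> \<le> D * (N0 - N')" using p less.prems(1) by (intro mult_le_mono2) linarith
          finally show ?thesis .
        qed
        then have IH: "W N' (\<lambda>i. \<beta> i + \<alpha> i) \<le> 2 * C * H ^ N' * G ^ (\<Sum>i\<in>UNIV. \<beta> i + \<alpha> i) *
            L powr (\<tau> * real N' + (\<Sum>i\<in>UNIV. s i * real (\<beta> i + \<alpha> i)))"
          using p less.prems(1) by (intro less.IH) auto
        define Y where "Y = 2 * C * H ^ N' * G ^ (\<Sum>i\<in>UNIV. \<beta> i + \<alpha> i) *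
            L powr (\<tau> * real N' + (\<Sum>i\<in>UNIV. s i * real (\<beta> i + \<alpha> i)))"
        have Y: "Y \<ge> 0" using pos by (simp add: Y_def)
        have ck: "0 \<le> c j \<alpha> n k" "c j \<alpha> n k \<le> A * Q ^ p * L powr (\<tau> * real p - (\<Sum>i\<in>UNIV. s i * \<alpha> i))"
          using c[OF \<Lambda> k] N less.prems(1) by (auto simp: p_def)
        have "c j \<alpha> n k * W N' (\<lambda>i. \<beta> i + \<alpha> i) \<le> c j \<alpha> n k * Y"
          using IH ck(1) unfolding Y_def by (rule mult_left_mono)
        also have "\<dots> \<le> A * Q ^ p * L powr (\<tau> * real p - (\<Sum>i\<in>UNIV. s i * \<alpha> i)) * Y"
          using ck(2) Y by (rule mult_right_mono)
        also have "\<dots> = Q ^ p * H ^ N' * (A * G ^ (\<Sum>i\<in>UNIV. \<alpha> i)) * (2 * C * G ^ (\<Sum>i\<in>UNIV. \<beta> i)) *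
            (L powr (\<tau> * real p - (\<Sum>i\<in>UNIV. s i * \<alpha> i)) * L powr (\<tau> * real N' + (\<Sum>i\<in>UNIV. s i * real (\<beta> i + \<alpha> i))))"
          by (simp add: Y_def sum.distrib power_add mult_ac)
        also have "L powr (\<tau> * real p - (\<Sum>i\<in>UNIV. s i * \<alpha> i)) * L powr (\<tau> * real N' + (\<Sum>i\<in>UNIV. s i * real (\<beta> i + \<alpha> i)))
            = L powr (\<tau> * real N + (\<Sum>i\<in>UNIV. s i * \<beta> i))"
          unfolding p(2) by (simp add: algebra_simps sum.distrib flip: powr_add)
        also have "Q ^ p * H ^ N' = x ^ p * H ^ N"
          using pos by (simp add: x_def p(2) power_add power_divide)
        finally show "c j \<alpha> n k * W (n - k + j) (\<lambda>i. \<beta> i + \<alpha> i)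
            \<le> x ^ (k + K - j) * ((A * G ^ (\<Sum>i\<in>UNIV. \<alpha> i)) * (2 * C * H ^ N * X))"
          by (simp add: X_def N'_def p_def mult_ac)
      qed
      also have "\<dots> \<le> 2 * x * ((A * G ^ (\<Sum>i\<in>UNIV. \<alpha> i)) * (2 * C * H ^ N * X))"
        unfolding sum_distrib_right[symmetric]
        using pos X by (intro mult_right_mono sum_geometric_shift_le x q \<Lambda>) auto
      finally show ?thesis by (simp only: mult.assoc)
    qed
    then have "(\<Sum>(j, \<alpha>)\<in>\<Lambda>. \<Sum>k=q j \<alpha>..n. c j \<alpha> n k * W (n - k + j) (\<lambda>i. \<beta> i + \<alpha> i))
        \<le> (\<Sum>(j, \<alpha>)\<in>\<Lambda>. 2 * x * (A * G ^ (\<Sum>i\<in>UNIV. \<alpha> i)) * (2 * C * H ^ N * X))"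
      by (intro sum_mono) auto
    also have "\<dots> = (4 * x * A * (\<Sum>(j, \<alpha>)\<in>\<Lambda>. G ^ (\<Sum>i\<in>UNIV. \<alpha> i))) * (C * H ^ N * X)"
      by (simp add: sum_distrib_left sum_distrib_right case_prod_unfold mult_ac)
    \<comment> \<open>The third lower bound on \<open>H\<close> is exactly this estimate. The source
      takes the other half of the constant \<open>2 * C\<close>.\<close>
    also have "\<dots> \<le> 1 * (C * H ^ N * X)"
      using pos H(3) by (intro mult_right_mono CHX) (simp add: x_def field_simps)
    finally have "W N \<beta> \<le> S N \<beta> + C * H ^ N * X"
      using rec[of n \<beta>] N less.prems(1) by simp
    also have "S N \<beta> \<le> C * H ^ N * X"
      using S0[where N = N and \<beta> = \<beta>, OF _ less.prems] False H0 by (simp add: X_def mult_ac)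
    finally show ?thesis by (simp add: X_def mult_ac)
  qed
qed

lemma mdiff_t_funpow:
  assumes "\<And>n. m n > 0"
  shows "(mdiff_t m ^^ k) u n \<gamma> = of_real (m (n + k) / m n) * u (n + k) \<gamma>"
proof (induction k arbitrary: n)
  case 0
  then show ?case using assms[of n] by simp
next
  case (Suc k)
  show ?case
    using Suc.IH[of "Suc n"] assms[of "Suc n"] assms[of n]
    by (simp add: mdiff_t_def[of m "(mdiff_t m ^^ k) u"])
qed

text \<open>The equation at degree \<open>n\<close> is solved for the coefficient at
  \<open>n + K\<close>. The quotients of \<open>m i\<close> produced by the operators turn the
  weight at \<open>\<gamma>\<close> into the weight at \<open>\<gamma> + \<alpha>\<close>, the
  numerator \<open>m0 (n - k + j)\<close> completes \<open>w\<close>, and of all the weights only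
  \<open>m0 n / m0 (n - k)\<close> remains as a factor.\<close>

lemma weighted_recursion:
  fixes u :: "nat \<Rightarrow> ('n::finite \<Rightarrow> nat) \<Rightarrow> complex"
    and m0 :: "nat \<Rightarrow> real" and m :: "'n \<Rightarrow> nat \<Rightarrow> real"
  assumes m0: "\<And>n. m0 n > 0" and m: "\<And>i n. m i n > 0"
    and q: "\<And>j \<alpha> k. (j, \<alpha>) \<in> \<Lambda> \<Longrightarrow> k < q j \<alpha> \<Longrightarrow> fps_nth (a j \<alpha>) k = 0"
  defines "w \<equiv> \<lambda>N \<delta>. m0 N * (\<Prod>i\<in>UNIV. m i (\<delta> i)) * cmod (u N \<delta>)"
  shows "w (n + K) \<gamma> \<le> m0 n * (\<Prod>i\<in>UNIV. m i (\<gamma> i)) * cmod (P_op K m0 m \<Lambda> a u n \<gamma>) +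
    (\<Sum>(j, \<alpha>)\<in>\<Lambda>. \<Sum>k=q j \<alpha>..n. cmod (fps_nth (a j \<alpha>) k) * (m0 n / m0 (n - k)) *
       w (n - k + j) (\<lambda>i. \<gamma> i + \<alpha> i))"
proof -
  define p where "p = (\<Prod>i\<in>UNIV. m i (\<gamma> i))"
  have p: "p > 0" unfolding p_def by (intro prod_pos) (simp add: m)
  define T where "T j \<alpha> = mult_t (a j \<alpha>) ((mdiff_t m0 ^^ j) (\<lambda>k. mdiff_multi m \<alpha> (u k))) n \<gamma>" for j \<alpha>
  have T: "m0 n * p * cmod (T j \<alpha>) \<le> (\<Sum>k=q j \<alpha>..n. cmod (fps_nth (a j \<alpha>) k) * (m0 n / m0 (n - k)) *
       w (n - k + j) (\<lambda>i. \<gamma> i + \<alpha> i))" if \<Lambda>: "(j, \<alpha>) \<in> \<Lambda>" for j \<alpha>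
  proof -
    define t where "t k = fps_nth (a j \<alpha>) k * (of_real (m0 (n - k + j) / m0 (n - k)) *
        (of_real (\<Prod>i\<in>UNIV. m i (\<gamma> i + \<alpha> i) / m i (\<gamma> i)) * u (n - k + j) (\<lambda>i. \<gamma> i + \<alpha> i)))" for k
    have "T j \<alpha> = (\<Sum>k=0..n. t k)"
      by (simp add: T_def mult_t_def fps_mult_nth mdiff_t_funpow[OF m0] mdiff_multi_coeff[OF m] t_def)
    also have "\<dots> = (\<Sum>k=q j \<alpha>..n. t k)"
      by (rule sum.mono_neutral_right) (use q[OF \<Lambda>] in \<open>auto simp: t_def\<close>)
    finally have "m0 n * p * cmod (T j \<alpha>) \<le> m0 n * p * (\<Sum>k=q j \<alpha>..n. cmod (t k))"
      using m0[of n] p by (auto intro!: mult_left_mono norm_sum)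
    also have "\<dots> = (\<Sum>k=q j \<alpha>..n. cmod (fps_nth (a j \<alpha>) k) * (m0 n / m0 (n - k)) *
       w (n - k + j) (\<lambda>i. \<gamma> i + \<alpha> i))"
      unfolding sum_distrib_left
    proof (rule sum.cong[OF refl])
      fix k
      have pos: "(\<Prod>i\<in>UNIV. m i (\<gamma> i + \<alpha> i)) > 0" by (intro prod_pos) (simp add: m)
      have "cmod (t k) = cmod (fps_nth (a j \<alpha>) k) * (m0 (n - k + j) / m0 (n - k) *
          ((\<Prod>i\<in>UNIV. m i (\<gamma> i + \<alpha> i)) / p * cmod (u (n - k + j) (\<lambda>i. \<gamma> i + \<alpha> i))))"
        unfolding t_def norm_mult norm_of_real prod_dividef p_def[symmetric]
        using m0[of "n - k + j"] m0[of "n - k"] p pos by simp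
      then show "m0 n * p * cmod (t k) = cmod (fps_nth (a j \<alpha>) k) * (m0 n / m0 (n - k)) *
          w (n - k + j) (\<lambda>i. \<gamma> i + \<alpha> i)"
        using p by (simp add: w_def)
    qed
    finally show ?thesis .
  qed
  have "P_op K m0 m \<Lambda> a u n \<gamma> = of_real (m0 (n + K) / m0 n) * u (n + K) \<gamma> + (\<Sum>(j, \<alpha>)\<in>\<Lambda>. T j \<alpha>)"
    by (simp add: P_op_def T_def mdiff_t_funpow[OF m0])
  then have "of_real (m0 (n + K) / m0 n) * u (n + K) \<gamma> = P_op K m0 m \<Lambda> a u n \<gamma> - (\<Sum>(j, \<alpha>)\<in>\<Lambda>. T j \<alpha>)"
    by simp
  then have "cmod (of_real (m0 (n + K) / m0 n) * u (n + K) \<gamma>) \<le>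
      cmod (P_op K m0 m \<Lambda> a u n \<gamma>) + cmod (\<Sum>(j, \<alpha>)\<in>\<Lambda>. T j \<alpha>)"
    by (metis norm_triangle_ineq4)
  moreover have "cmod (\<Sum>(j, \<alpha>)\<in>\<Lambda>. T j \<alpha>) \<le> (\<Sum>(j, \<alpha>)\<in>\<Lambda>. cmod (T j \<alpha>))"
    using norm_sum[of "\<lambda>(j, \<alpha>). T j \<alpha>" \<Lambda>] by (simp add: case_prod_unfold)
  ultimately have "m0 n * p * cmod (of_real (m0 (n + K) / m0 n) * u (n + K) \<gamma>) \<le>
      m0 n * p * (cmod (P_op K m0 m \<Lambda> a u n \<gamma>) + (\<Sum>(j, \<alpha>)\<in>\<Lambda>. cmod (T j \<alpha>)))"
    using m0[of n] p by (intro mult_left_mono) auto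
  also have "m0 n * p * cmod (of_real (m0 (n + K) / m0 n) * u (n + K) \<gamma>) = w (n + K) \<gamma>"
    using m0[of n] m0[of "n + K"] by (simp add: w_def p_def norm_mult norm_divide)
  also have "m0 n * p * (cmod (P_op K m0 m \<Lambda> a u n \<gamma>) + (\<Sum>(j, \<alpha>)\<in>\<Lambda>. cmod (T j \<alpha>)))
      = m0 n * p * cmod (P_op K m0 m \<Lambda> a u n \<gamma>) + (\<Sum>(j, \<alpha>)\<in>\<Lambda>. m0 n * p * cmod (T j \<alpha>))"
    by (simp add: distrib_left sum_distrib_left case_prod_unfold)
  also have "\<dots> \<le> m0 n * p * cmod (P_op K m0 m \<Lambda> a u n \<gamma>) +
    (\<Sum>(j, \<alpha>)\<in>\<Lambda>. \<Sum>k=q j \<alpha>..n. cmod (fps_nth (a j \<alpha>) k) * (m0 n / m0 (n - k)) *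
       w (n - k + j) (\<lambda>i. \<gamma> i + \<alpha> i))"
    using T by (intro add_left_mono sum_mono) (simp only: split_paired_all prod.case)
  finally show ?thesis by (simp add: p_def)
qed

section \<open>Coefficient estimates in terms of the ratios of the weight sequence\<close>

context weight_sequence
begin

text \<open>Telescoping: regularity bounds each of the \<open>k\<close> consecutive quotients, so
  the loss is only \<open>A ^ k\<close>. Separate bounds on \<open>m0 n\<close> and
  \<open>m0 (n - k)\<close> would lose a factor geometric in \<open>n\<close>.\<close>

lemma regular_quotient_le:
  assumes pos: "\<And>n. m0 n > 0" and A: "A > 0"
    and reg: "\<And>n. n \<ge> 1 \<Longrightarrow> m0 n / m0 (n - 1) \<le> A * (M n / M (n - 1)) powr s0"
    and s0: "s0 \<ge> 0" and le: "n \<le> Suc N" "k \<le> n"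
  shows "m0 n / m0 (n - k) \<le> A ^ k * ratio N powr (s0 * real k)"
  using \<open>k \<le> n\<close>
proof (induction k)
  case 0
  then show ?case using pos[of n] ratio_pos[of N] by simp
next
  case (Suc k)
  define l where "l = n - Suc k"
  have l: "n - k = Suc l" using Suc.prems by (simp add: l_def)
  have "m0 (Suc l) / m0 l \<le> A * ratio l powr s0"
    using reg[of "Suc l"] by (simp add: ratio_def)
  also have "\<dots> \<le> A * ratio N powr s0"
    using A s0 le Suc.prems ratio_pos
    by (intro mult_left_mono powr_mono2 incseqD[OF incseq_ratio]) (auto simp: l_def intro: less_imp_le)
  finally have "(m0 n / m0 (Suc l)) * (m0 (Suc l) / m0 l)
      \<le> (A ^ k * ratio N powr (s0 * real k)) * (A * ratio N powr s0)"
    using Suc A pos by (intro mult_mono) (auto simp: l intro: less_imp_le divide_nonneg_pos)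
  moreover have "(m0 n / m0 (Suc l)) * (m0 (Suc l) / m0 l) = m0 n / m0 l"
    using pos[of "Suc l"] by simp
  ultimately have "m0 n / m0 l \<le> (A ^ k * ratio N powr (s0 * real k)) * (A * ratio N powr s0)"
    by (simp only:)
  then show ?case
    by (simp add: l_def[symmetric] algebra_simps powr_add)
qed

text \<open>Moderate growth splits \<open>M (\<gamma> i + \<beta> i)\<close>, and
  \<open>M_le_dyadic\<close> turns \<open>M (\<beta> i)\<close> into powers of
  \<open>ratio N\<close>. The factors \<open>M (\<gamma> i) powr s i\<close> are kept, to be
  cancelled later by the lower bounds on \<open>m i\<close>.\<close>

lemma weight_shift_le:
  fixes m :: "'n::finite \<Rightarrow> nat \<Rightarrow> real"
  assumes m: "\<And>i n. 0 \<le> m i n \<and> m i n \<le> A ^ n * M n powr s i"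
    and A: "A \<ge> 1" and s: "\<And>i. s i \<ge> 0"
    and \<beta>: "\<And>i. \<beta> i \<le> 2 ^ d * N"
  defines "T \<equiv> (B ^ 3) ^ d" and "\<sigma> \<equiv> \<Sum>i\<in>UNIV. s i"
  shows "(\<Prod>i\<in>UNIV. m i (\<gamma> i + \<beta> i)) \<le> (A * (B * T) powr \<sigma>) ^ (\<Sum>i\<in>UNIV. \<gamma> i + \<beta> i) *
    (\<Prod>i\<in>UNIV. M (\<gamma> i) powr s i) * ratio N powr (\<Sum>i\<in>UNIV. s i * \<beta> i)"
proof -
  have T: "T \<ge> 1" using B by (simp add: T_def one_le_power)
  have L: "ratio N > 0" by (rule ratio_pos)
  have single: "m i (\<gamma> i + \<beta> i) \<le> (A * (B * T) powr \<sigma>) ^ (\<gamma> i + \<beta> i) * M (\<gamma> i) powr s i *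
      ratio N powr (s i * \<beta> i)" for i
  proof -
    let ?n = "\<gamma> i + \<beta> i"
    have "s i \<le> \<sigma>" unfolding \<sigma>_def using s by (intro member_le_sum) auto
    have "M ?n \<le> B ^ ?n * M (\<gamma> i) * M (\<beta> i)" by (rule mg)
    also have "\<dots> \<le> B ^ ?n * M (\<gamma> i) * (T * ratio N) ^ \<beta> i"
      using M_le_dyadic[OF \<beta>[of i]] B M_pos[of "\<gamma> i"] unfolding T_def by (intro mult_left_mono) auto
    \<comment> \<open>The exponent of \<open>T\<close> is enlarged so that \<open>B\<close> and
      \<open>T\<close> merge into one geometric factor.\<close>
    also have "\<dots> \<le> B ^ ?n * M (\<gamma> i) * (T ^ ?n * ratio N ^ \<beta> i)"
      using B T L M_pos[of "\<gamma> i"] unfolding power_mult_distrib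
      by (intro mult_left_mono mult_right_mono power_increasing) auto
    also have "\<dots> = (B * T) ^ ?n * M (\<gamma> i) * ratio N ^ \<beta> i" by (simp add: power_mult_distrib)
    finally have "M ?n powr s i \<le> ((B * T) ^ ?n * M (\<gamma> i) * ratio N ^ \<beta> i) powr s i"
      using M_pos[of ?n] s by (intro powr_mono2) auto
    also have "\<dots> = ((B * T) powr s i) ^ ?n * M (\<gamma> i) powr s i * ratio N powr (s i * \<beta> i)"
      using B T L by (simp add: powr_mult powr_powr mult.commute flip: powr_realpow)
    also have "\<dots> \<le> ((B * T) powr \<sigma>) ^ ?n * M (\<gamma> i) powr s i * ratio N powr (s i * \<beta> i)"
    proof (intro mult_right_mono power_mono powr_mono \<open>s i \<le> \<sigma>\<close>)
      show "1 \<le> B * T" using mult_mono[OF B T] B by simp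
    qed auto
    finally have "A ^ ?n * M ?n powr s i \<le> A ^ ?n * (((B * T) powr \<sigma>) ^ ?n * M (\<gamma> i) powr s i * ratio N powr (s i * \<beta> i))"
      using A by (intro mult_left_mono) auto
    then show ?thesis using m[of i ?n] by (simp add: power_mult_distrib mult_ac)
  qed
  have "(\<Prod>i\<in>UNIV. m i (\<gamma> i + \<beta> i)) \<le> (\<Prod>i\<in>UNIV. (A * (B * T) powr \<sigma>) ^ (\<gamma> i + \<beta> i) * M (\<gamma> i) powr s i *
      ratio N powr (s i * \<beta> i))"
    using m single by (intro prod_mono conjI) auto
  also have "\<dots> = (A * (B * T) powr \<sigma>) ^ (\<Sum>i\<in>UNIV. \<gamma> i + \<beta> i) *
    (\<Prod>i\<in>UNIV. M (\<gamma> i) powr s i) * (\<Prod>i\<in>UNIV. ratio N powr (s i * \<beta> i))"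
    by (simp add: prod.distrib power_sum)
  also have "(\<Prod>i\<in>UNIV. ratio N powr (s i * \<beta> i)) = ratio N powr (\<Sum>i\<in>UNIV. s i * \<beta> i)"
    using L by (intro powr_sum[symmetric]) auto
  finally show ?thesis .
qed

text \<open>For each \<open>(N0, \<gamma>)\<close>, \<open>majorant_bound\<close> is applied to
  \<open>w\<close> translated by \<open>\<gamma>\<close>, with \<open>L = ratio N0\<close>. Only the
  constant \<open>C\<close> depends on \<open>\<gamma>\<close>, explicitly, while \<open>H\<close>
  and \<open>G\<close> are uniform. Finally \<open>ratio_power_le\<close> returns from
  \<open>L\<close> to \<open>M N0\<close>, and the lower bounds on \<open>m0\<close> and
  \<open>m i\<close> remove the weights.\<close>

lemma coefficient_bound:
  fixes u F :: "nat \<Rightarrow> ('n::finite \<Rightarrow> nat) \<Rightarrow> complex"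
    and m0 :: "nat \<Rightarrow> real" and m :: "'n \<Rightarrow> nat \<Rightarrow> real"
    and c :: "nat \<Rightarrow> ('n \<Rightarrow> nat) \<Rightarrow> nat \<Rightarrow> nat \<Rightarrow> real"
  assumes \<kappa>: "\<kappa> \<ge> 0" and s0: "s0 \<ge> 0" and s: "\<And>i. s i \<ge> 0"
    and m0: "\<And>n. a0 ^ n * M n powr s0 \<le> m0 n" "\<And>n. m0 n \<le> A0 ^ n * M n powr s0" "a0 > 0" "A0 > 0"
    and m: "\<And>i n. b ^ n * M n powr s i \<le> m i n" "\<And>i n. m i n \<le> A1 ^ n * M n powr s i" "b > 0" "A1 \<ge> 1"
    and F: "\<And>n \<gamma>. cmod (F n \<gamma>) * r ^ (\<Sum>i\<in>UNIV. \<gamma> i) \<le> Af * Bf ^ n * M n powr \<kappa>" "r > 0" "Bf > 0"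
    and init: "\<And>N \<gamma>. N < K \<Longrightarrow> m0 N * cmod (u N \<gamma>) * r ^ (\<Sum>i\<in>UNIV. \<gamma> i) \<le> \<Phi>"
    and pos: "Af > 0" "\<Phi> > 0" "A \<ge> 0" "Q \<ge> 0"
    and fin: "finite \<Lambda>"
  defines "w \<equiv> \<lambda>N \<delta>. m0 N * (\<Prod>i\<in>UNIV. m i (\<delta> i)) * cmod (u N \<delta>)"
  assumes rec: "\<And>n \<gamma>. w (n + K) \<gamma> \<le> m0 n * (\<Prod>i\<in>UNIV. m i (\<gamma> i)) * cmod (F n \<gamma>) +
      (\<Sum>(j, \<alpha>)\<in>\<Lambda>. \<Sum>k=q j \<alpha>..n. c j \<alpha> n k * w (n - k + j) (\<lambda>i. \<gamma> i + \<alpha> i))"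
    and q: "\<And>j \<alpha>. (j, \<alpha>) \<in> \<Lambda> \<Longrightarrow> j < q j \<alpha> + K"
    and c: "\<And>N j \<alpha> n k. (j, \<alpha>) \<in> \<Lambda> \<Longrightarrow> q j \<alpha> \<le> k \<Longrightarrow> k \<le> n \<Longrightarrow> n + K \<le> N \<Longrightarrow>
        0 \<le> c j \<alpha> n k \<and> c j \<alpha> n k \<le> A * Q ^ (k + K - j) *
          ratio N powr ((\<kappa> + s0) * real (k + K - j) - (\<Sum>i\<in>UNIV. s i * \<alpha> i))"
  shows "\<exists>C>0. \<exists>H>0. \<exists>G>0. \<forall>n \<gamma>. cmod (u n \<gamma>) \<le> C * H ^ n * M n powr \<kappa> * G ^ (\<Sum>i\<in>UNIV. \<gamma> i)"
proof -
  \<comment> \<open>The entries of the shifts are then bounded by \<open>2 ^ D\<close>; a power of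
    two is what \<open>M_le_dyadic\<close> requires.\<close>
  define D where "D = (\<Sum>(j, \<alpha>)\<in>\<Lambda>. \<Sum>i\<in>UNIV. \<alpha> i)"
  have D: "\<alpha> i \<le> 2 ^ D" if "(j, \<alpha>) \<in> \<Lambda>" for j \<alpha> i
  proof -
    have "\<alpha> i \<le> (\<Sum>i\<in>UNIV. \<alpha> i)" by (rule member_le_sum) auto
    also have "\<dots> \<le> D"
      using member_le_sum[OF that, of "\<lambda>(j, \<alpha>). \<Sum>i\<in>UNIV. \<alpha> i"] fin by (simp add: D_def)
    also have "D \<le> 2 ^ D" by (rule less_imp_le[OF less_exp])
    finally show ?thesis .
  qed
  have m0_pos: "m0 n > 0" for n
    using m0(1)[of n] M_pos[of n] m0(3) by (auto intro: less_le_trans[rotated])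
  have m_pos: "m i n > 0" for i n
    using m(1)[of n i] M_pos[of n] m(3) by (auto intro: less_le_trans[rotated])
  define E where "E = A1 * (B * (B ^ 3) ^ D) powr (\<Sum>i\<in>UNIV. s i)"
  have E: "E > 0" using m(4) B by (simp add: E_def)
  \<comment> \<open>Besides the growth \<open>E\<close> of the weights, \<open>G\<close> carries the
    radius \<open>r\<close> of the Cauchy estimates.\<close>
  define G where "G = E / r"
  have G: "G > 0" using E F(2) by (simp add: G_def)
  \<comment> \<open>At least 1 for the initial data and at least \<open>A0 * Bf\<close> for the
    source; \<open>H\<close> then meets the three requirements of
    \<open>majorant_bound\<close>.\<close>
  define H0 where "H0 = max 1 (A0 * Bf)"
  define H where "H = max (max H0 (2 * Q)) (4 * Q * A * (\<Sum>(j, \<alpha>)\<in>\<Lambda>. G ^ (\<Sum>i\<in>UNIV. \<alpha> i)))"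
  have H0: "H0 \<ge> 1" by (simp add: H0_def)
  have H: "H0 \<le> H" "2 * Q \<le> H" "4 * Q * A * (\<Sum>(j, \<alpha>)\<in>\<Lambda>. G ^ (\<Sum>i\<in>UNIV. \<alpha> i)) \<le> H" "H > 0"
    using H0 by (auto simp: H_def)
  define C1 where "C1 = Af + \<Phi>"
  have C1: "C1 > 0" using pos by (simp add: C1_def)
  \<comment> \<open>The target order \<open>\<kappa>\<close> plus the order \<open>s0\<close> of
    \<open>m0\<close>, which is a factor of \<open>w\<close>.\<close>
  define \<tau> where "\<tau> = \<kappa> + s0"
  have \<tau>: "\<tau> \<ge> 0" using \<kappa> s0 by (simp add: \<tau>_def)
  define M\<gamma> where "M\<gamma> \<gamma> = (\<Prod>i\<in>UNIV. M (\<gamma> i) powr s i)" for \<gamma> :: "'n \<Rightarrow> nat"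
  have M\<gamma>: "M\<gamma> \<gamma> > 0" for \<gamma> unfolding M\<gamma>_def using M_pos by (intro prod_pos) (simp add: less_imp_neq[OF M_pos, THEN not_sym])
  have w_le: "w N0 \<gamma> \<le> 2 * (C1 * M\<gamma> \<gamma> * G ^ (\<Sum>i\<in>UNIV. \<gamma> i)) * H ^ N0 * ratio N0 powr (\<tau> * real N0)" for N0 \<gamma>
  proof -
    define L where "L = ratio N0"
    have L: "L \<ge> 1" unfolding L_def by (rule ratio_ge_1)
    define C where "C = C1 * M\<gamma> \<gamma> * G ^ (\<Sum>i\<in>UNIV. \<gamma> i)"
    have C: "C > 0" using C1 M\<gamma> G by (simp add: C_def)
    have prod_le: "(\<Prod>i\<in>UNIV. m i (\<gamma> i + \<beta> i)) / r ^ (\<Sum>i\<in>UNIV. \<gamma> i + \<beta> i) \<le>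
        M\<gamma> \<gamma> * G ^ (\<Sum>i\<in>UNIV. \<gamma> i) * G ^ (\<Sum>i\<in>UNIV. \<beta> i) * L powr (\<Sum>i\<in>UNIV. s i * \<beta> i)"
      if "\<And>i. \<beta> i \<le> 2 ^ D * (N0 - N)" for \<beta> N
    proof -
      have "\<beta> i \<le> 2 ^ D * N0" for i
        using that[of i] by (rule order_trans) simp
      then have "(\<Prod>i\<in>UNIV. m i (\<gamma> i + \<beta> i)) \<le> E ^ (\<Sum>i\<in>UNIV. \<gamma> i + \<beta> i) * M\<gamma> \<gamma> * L powr (\<Sum>i\<in>UNIV. s i * \<beta> i)"
        unfolding E_def M\<gamma>_def L_def using m(2,4) s m_pos
        by (intro weight_shift_le) (auto intro: less_imp_le)
      then have "(\<Prod>i\<in>UNIV. m i (\<gamma> i + \<beta> i)) / r ^ (\<Sum>i\<in>UNIV. \<gamma> i + \<beta> i) \<le>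
          E ^ (\<Sum>i\<in>UNIV. \<gamma> i + \<beta> i) * M\<gamma> \<gamma> * L powr (\<Sum>i\<in>UNIV. s i * \<beta> i) / r ^ (\<Sum>i\<in>UNIV. \<gamma> i + \<beta> i)"
        using F(2) by (intro divide_right_mono) auto
      also have "\<dots> = M\<gamma> \<gamma> * G ^ (\<Sum>i\<in>UNIV. \<gamma> i) * G ^ (\<Sum>i\<in>UNIV. \<beta> i) * L powr (\<Sum>i\<in>UNIV. s i * \<beta> i)"
        by (simp add: G_def power_divide sum.distrib power_add)
      finally show ?thesis .
    qed
    \<comment> \<open>One estimate for both kinds of data: \<open>X\<close> is a value of
      \<open>m0\<close>, and \<open>Y\<close> the modulus of a coefficient of the source or of the
      solution.\<close>
    have source: "X * (\<Prod>i\<in>UNIV. m i (\<gamma> i + \<beta> i)) * Y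
        \<le> C * H0 ^ N * G ^ (\<Sum>i\<in>UNIV. \<beta> i) * L powr (\<tau> * real N + (\<Sum>i\<in>UNIV. s i * \<beta> i))"
      if \<beta>: "\<And>i. \<beta> i \<le> 2 ^ D * (N0 - N)" and XY: "X * Y * r ^ (\<Sum>i\<in>UNIV. \<gamma> i + \<beta> i) \<le> C1 * H0 ^ N * L powr (\<tau> * real N)"
      for \<beta> N X Y
    proof -
      have "X * (\<Prod>i\<in>UNIV. m i (\<gamma> i + \<beta> i)) * Y = (X * Y * r ^ (\<Sum>i\<in>UNIV. \<gamma> i + \<beta> i)) *
          ((\<Prod>i\<in>UNIV. m i (\<gamma> i + \<beta> i)) / r ^ (\<Sum>i\<in>UNIV. \<gamma> i + \<beta> i))"
        using F(2) by simp
      also have "\<dots> \<le> (C1 * H0 ^ N * L powr (\<tau> * real N)) *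
          (M\<gamma> \<gamma> * G ^ (\<Sum>i\<in>UNIV. \<gamma> i) * G ^ (\<Sum>i\<in>UNIV. \<beta> i) * L powr (\<Sum>i\<in>UNIV. s i * \<beta> i))"
        using C1 H0 F(2) m_pos
        by (intro mult_mono XY prod_le[OF \<beta>]) (auto intro!: mult_nonneg_nonneg divide_nonneg_pos prod_nonneg intro: less_imp_le)
      also have "\<dots> = C * H0 ^ N * G ^ (\<Sum>i\<in>UNIV. \<beta> i) * L powr (\<tau> * real N + (\<Sum>i\<in>UNIV. s i * \<beta> i))"
        by (simp add: C_def powr_add)
      finally show ?thesis .
    qed
    \<comment> \<open>At level \<open>N0\<close> the window contains only
      \<open>\<beta> = 0\<close>, which is the index wanted.\<close>
    have "w N0 (\<lambda>i. \<gamma> i + 0) \<le> 2 * C * H ^ N0 * G ^ (\<Sum>i\<in>(UNIV :: 'n set). 0) * L powr (\<tau> * real N0 + (\<Sum>i\<in>UNIV. s i * real 0))"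
    proof (rule majorant_bound[where W = "\<lambda>N \<beta>. w N (\<lambda>i. \<gamma> i + \<beta> i)" and \<beta> = "\<lambda>_. 0" and K = K and D = "2 ^ D"
          and S = "\<lambda>N \<beta>. m0 (N - K) * (\<Prod>i\<in>UNIV. m i (\<gamma> i + \<beta> i)) * cmod (F (N - K) (\<lambda>i. \<gamma> i + \<beta> i))"
          and c = c and q = q and \<Lambda> = \<Lambda> and A = A and Q = Q and ?H0.0 = H0])
      show "w (n + K) (\<lambda>i. \<gamma> i + \<beta> i) \<le> m0 (n + K - K) * (\<Prod>i\<in>UNIV. m i (\<gamma> i + \<beta> i)) * cmod (F (n + K - K) (\<lambda>i. \<gamma> i + \<beta> i)) +
        (\<Sum>(j, \<alpha>)\<in>\<Lambda>. \<Sum>k=q j \<alpha>..n. c j \<alpha> n k * w (n - k + j) (\<lambda>i. \<gamma> i + (\<beta> i + \<alpha> i)))" for n \<beta>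
        using rec[of n "\<lambda>i. \<gamma> i + \<beta> i"] by (simp add: add.assoc)
      show "0 \<le> c j \<alpha> n k \<and> c j \<alpha> n k \<le> A * Q ^ (k + K - j) * L powr (\<tau> * real (k + K - j) - (\<Sum>i\<in>UNIV. s i * \<alpha> i))"
        if "(j, \<alpha>) \<in> \<Lambda>" "q j \<alpha> \<le> k" "k \<le> n" "n + K \<le> N0" for j \<alpha> n k
        unfolding \<tau>_def L_def by (rule c[OF that])
      show "w N (\<lambda>i. \<gamma> i + \<beta> i) \<le> C * H0 ^ N * G ^ (\<Sum>i\<in>UNIV. \<beta> i) * L powr (\<tau> * real N + (\<Sum>i\<in>UNIV. s i * \<beta> i))"
        if "N < K" "\<And>i. \<beta> i \<le> 2 ^ D * (N0 - N)" for N \<beta>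
        unfolding w_def
      proof (rule source[OF that(2)])
        have "m0 N * cmod (u N (\<lambda>i. \<gamma> i + \<beta> i)) * r ^ (\<Sum>i\<in>UNIV. \<gamma> i + \<beta> i) \<le> C1 * (1 * 1)"
          using init[OF that(1), of "\<lambda>i. \<gamma> i + \<beta> i"] pos by (simp add: C1_def)
        also have "\<dots> \<le> C1 * (H0 ^ N * L powr (\<tau> * real N))"
          using C1 H0 L \<tau> by (intro mult_left_mono mult_mono one_le_power ge_one_powr_ge_zero) auto
        finally show "m0 N * cmod (u N (\<lambda>i. \<gamma> i + \<beta> i)) * r ^ (\<Sum>i\<in>UNIV. \<gamma> i + \<beta> i) \<le> C1 * H0 ^ N * L powr (\<tau> * real N)"
          by simp
      qed
      show "m0 (N - K) * (\<Prod>i\<in>UNIV. m i (\<gamma> i + \<beta> i)) * cmod (F (N - K) (\<lambda>i. \<gamma> i + \<beta> i))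
          \<le> C * H0 ^ N * G ^ (\<Sum>i\<in>UNIV. \<beta> i) * L powr (\<tau> * real N + (\<Sum>i\<in>UNIV. s i * \<beta> i))"
        if N: "K \<le> N" "N \<le> N0" and \<beta>: "\<And>i. \<beta> i \<le> 2 ^ D * (N0 - N)" for N \<beta>
      proof (rule source[OF \<beta>])
        \<comment> \<open>The source of degree \<open>n\<close> in \<open>t\<close> enters at level
          \<open>N = n + K\<close>; passing to the larger exponent \<open>N\<close> is free because
          \<open>L\<close> and \<open>H0\<close> are at least 1.\<close>
        define n where "n = N - K"
        have "M n powr \<tau> \<le> (L ^ n) powr \<tau>"
          unfolding L_def using N M_pos \<tau> by (intro powr_mono2 M_le_ratio_power) (auto simp: n_def intro: less_imp_le)
        also have "\<dots> = L powr (\<tau> * real n)"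
          using L by (simp add: powr_powr mult.commute flip: powr_realpow)
        also have "\<dots> \<le> L powr (\<tau> * real N)"
          using L \<tau> by (intro powr_mono mult_left_mono) (auto simp: n_def)
        finally have M\<tau>: "M n powr \<tau> \<le> L powr (\<tau> * real N)" .
        have "m0 n * (cmod (F n (\<lambda>i. \<gamma> i + \<beta> i)) * r ^ (\<Sum>i\<in>UNIV. \<gamma> i + \<beta> i))
            \<le> (A0 ^ n * M n powr s0) * (Af * Bf ^ n * M n powr \<kappa>)"
          by (rule mult_mono[OF m0(2) F(1)]) (use m0(4) F(2) in auto)
        also have "\<dots> = Af * (A0 * Bf) ^ n * M n powr \<tau>"
          by (simp add: \<tau>_def powr_add power_mult_distrib)
        also have "\<dots> \<le> C1 * H0 ^ N * L powr (\<tau> * real N)"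
        proof (intro mult_mono M\<tau>)
          have "(A0 * Bf) ^ n \<le> H0 ^ n"
            using m0(4) F(3) by (intro power_mono) (auto simp: H0_def)
          also have "\<dots> \<le> H0 ^ N" using H0 by (intro power_increasing) (auto simp: n_def)
          finally show "(A0 * Bf) ^ n \<le> H0 ^ N" .
        qed (use pos C1 H0 m0(4) F(3) in \<open>auto simp: C1_def\<close>)
        finally show "m0 (N - K) * cmod (F (N - K) (\<lambda>i. \<gamma> i + \<beta> i)) * r ^ (\<Sum>i\<in>UNIV. \<gamma> i + \<beta> i)
            \<le> C1 * H0 ^ N * L powr (\<tau> * real N)"
          by (simp add: n_def)
      qed
    qed (use q D C pos G L H H0 in auto)
    then show ?thesis by (simp add: C_def L_def)
  qed
  have "cmod (u n \<gamma>) \<le> 2 * C1 * (H * B powr (2 * \<tau>) / a0) ^ n * M n powr \<kappa> * (G / b) ^ (\<Sum>i\<in>UNIV. \<gamma> i)" for n \<gamma>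
  proof -
    \<comment> \<open>A lower bound for the weight of \<open>u n \<gamma>\<close> in
      \<open>w\<close>. Dividing by it lowers the order \<open>\<tau>\<close> to
      \<open>\<kappa>\<close> and cancels \<open>M\<gamma> \<gamma>\<close>.\<close>
    define p where "p = a0 ^ n * M n powr s0 * (b ^ (\<Sum>i\<in>UNIV. \<gamma> i) * M\<gamma> \<gamma>)"
    have p: "p > 0" using m0(3) m(3) M_pos[of n] M\<gamma> by (simp add: p_def)
    have "(ratio n ^ n) powr \<tau> \<le> (B ^ (2 * n) * M n) powr \<tau>"
      using \<tau> ratio_pos by (intro powr_mono2 ratio_power_le) (auto intro: less_imp_le)
    also have "\<dots> = (B powr (2 * \<tau>)) ^ n * M n powr \<tau>"
      using B by (simp add: powr_mult powr_powr mult_ac flip: powr_realpow)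
    finally have \<rho>: "ratio n powr (\<tau> * real n) \<le> (B powr (2 * \<tau>)) ^ n * M n powr \<tau>"
      using ratio_pos[of n] by (simp add: powr_powr mult.commute flip: powr_realpow)
    have "b ^ (\<Sum>i\<in>UNIV. \<gamma> i) * M\<gamma> \<gamma> = (\<Prod>i\<in>UNIV. b ^ \<gamma> i * M (\<gamma> i) powr s i)"
      by (simp add: M\<gamma>_def prod.distrib power_sum)
    also have "\<dots> \<le> (\<Prod>i\<in>UNIV. m i (\<gamma> i))"
      using m(1,3) by (intro prod_mono) auto
    finally have "p * cmod (u n \<gamma>) \<le> w n \<gamma>"
      unfolding p_def w_def using m0(1)[of n] m0_pos[of n] m(3) M\<gamma>
      by (intro mult_mono mult_right_mono) (auto intro!: mult_nonneg_nonneg intro: less_imp_le)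
    also have "\<dots> \<le> 2 * (C1 * M\<gamma> \<gamma> * G ^ (\<Sum>i\<in>UNIV. \<gamma> i)) * H ^ n * ((B powr (2 * \<tau>)) ^ n * M n powr \<tau>)"
      using C1 M\<gamma> G H by (intro order_trans[OF w_le] mult_left_mono \<rho>) (auto intro!: mult_nonneg_nonneg intro: less_imp_le)
    also have "\<dots> = p * (2 * C1 * (H * B powr (2 * \<tau>) / a0) ^ n * M n powr \<kappa> * (G / b) ^ (\<Sum>i\<in>UNIV. \<gamma> i))"
      using m0(3) m(3) by (simp add: p_def \<tau>_def powr_add power_divide power_mult_distrib)
    finally show ?thesis using p by simp
  qed
  moreover have "2 * C1 > 0" "H * B powr (2 * \<tau>) / a0 > 0" "G / b > 0"
    using C1 H G B m0(3) m(3) by auto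
  ultimately show ?thesis by blast
qed

end

text \<open>This is where the slope enters. Splitting off the constant \<open>M q\<close> leaves
  only \<open>k - q\<close> ratios in \<open>M k\<close>, so the exponent of \<open>ratio N\<close>
  is \<open>\<kappa> * (k - q) + s0 * k\<close>. Its difference from
  \<open>(\<kappa> + s0) * (k + K - j) - \<sigma>\<close> does not depend on \<open>k\<close>, and
  the sign of this difference is the hypothesis \<open>slope\<close>.\<close>

lemma (in weight_sequence) gevrey_coefficient_le:
  fixes \<sigma> :: real
  assumes ak: "ak \<le> A * b ^ k * M k powr \<kappa>" "0 \<le> A" "0 \<le> b" "0 \<le> \<kappa>"
    and mk: "0 \<le> mk" "mk \<le> A' ^ k * ratio N powr (s0 * real k)"
    and k: "q \<le> k" "k \<le> N" "j < q + K"
    and slope: "s0 * (real j - real K) + \<sigma> \<le> \<kappa> * (real q - real j + real K)"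
    and Q: "1 \<le> Q" "b * A' \<le> Q" "0 \<le> A'"
  shows "ak * mk \<le> (A * M q powr \<kappa> * Q ^ j) * Q ^ (k + K - j) *
    ratio N powr ((\<kappa> + s0) * real (k + K - j) - \<sigma>)"
proof -
  have "M k \<le> M q * ratio N ^ (k - q)"
    using M_add_le[of q "k - q" N] k by simp
  then have "M k powr \<kappa> \<le> (M q * ratio N ^ (k - q)) powr \<kappa>"
    using M_pos[of k] ak(4) by (intro powr_mono2) auto
  also have "\<dots> = M q powr \<kappa> * ratio N powr (\<kappa> * real (k - q))"
    using ratio_pos[of N] by (simp add: powr_mult powr_powr mult.commute flip: powr_realpow)
  finally have Mk: "M k powr \<kappa> \<le> M q powr \<kappa> * ratio N powr (\<kappa> * real (k - q))" .
  have "ak * mk \<le> (A * b ^ k * M k powr \<kappa>) * (A' ^ k * ratio N powr (s0 * real k))"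
    using ak mk Q by (intro mult_mono) auto
  also have "\<dots> \<le> (A * b ^ k * (M q powr \<kappa> * ratio N powr (\<kappa> * real (k - q)))) * (A' ^ k * ratio N powr (s0 * real k))"
    using ak Q Mk by (intro mult_right_mono mult_left_mono) auto
  also have "\<dots> = A * M q powr \<kappa> * (b * A') ^ k * ratio N powr (\<kappa> * real (k - q) + s0 * real k)"
    by (simp add: power_mult_distrib powr_add)
  \<comment> \<open>For \<open>j > K\<close> the exponent \<open>k + K - j\<close> is smaller than
    \<open>k\<close>; the constant \<open>Q ^ j\<close> compensates.\<close>
  also have "\<dots> \<le> A * M q powr \<kappa> * Q ^ (j + (k + K - j)) * ratio N powr ((\<kappa> + s0) * real (k + K - j) - \<sigma>)"
  proof (intro mult_mono powr_mono ratio_ge_1)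
    have "(b * A') ^ k \<le> Q ^ k" using ak Q by (intro power_mono) auto
    also have "\<dots> \<le> Q ^ (j + (k + K - j))" using Q k by (intro power_increasing) auto
    finally show "(b * A') ^ k \<le> Q ^ (j + (k + K - j))" .
    have "real (k - q) = real k - real q" "real (k + K - j) = real k + real K - real j"
      using k by (simp_all add: of_nat_diff)
    then show "\<kappa> * real (k - q) + s0 * real k \<le> (\<kappa> + s0) * real (k + K - j) - \<sigma>"
      using slope by (simp add: algebra_simps)
  qed (use ak Q M_ge_1 in auto)
  finally show ?thesis by (simp add: power_add mult_ac)
qed

section \<open>The Gevrey estimate for the formal solution\<close>

theorem theorem1:
  fixes K :: nat
    and M m0 :: "nat \<Rightarrow> real" and m :: "'n::finite \<Rightarrow> nat \<Rightarrow> real"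
    and s0 :: real and s :: "'n \<Rightarrow> real"
    and \<Lambda> :: "(nat \<times> ('n \<Rightarrow> nat)) set"
    and a :: "nat \<Rightarrow> ('n \<Rightarrow> nat) \<Rightarrow> complex fps"
    and R :: real
    and \<phi> f :: "nat \<Rightarrow> complex ^ 'n \<Rightarrow> complex"
    and u :: "nat \<Rightarrow> ('n \<Rightarrow> nat) \<Rightarrow> complex"
  assumes "K \<ge> 1"
    and "incseq M" and "\<And>n. M n > 0" and "M 0 = 1"
    and "log_convex_seq M" and "moderate_growth M"
    and "s0 \<ge> 0" and "\<And>i. s i \<ge> 0"
    and "M_sequence M s0 m0" and "\<And>i. M_sequence M (s i) (m i)"
    and "finite \<Lambda>"
    and "\<And>j \<alpha>. (j, \<alpha>) \<in> \<Lambda> \<Longrightarrow> a j \<alpha> \<noteq> 0 \<Longrightarrow>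
           int (subdegree (a j \<alpha>)) \<ge> max 0 (int j - int K + 1)"
    and "R > 0"
    and "\<And>j. j < K \<Longrightarrow> holomorphic_several (\<phi> j) (polydisc R)"
    and "f \<in> gevrey_holomorphic R M (inv_k1 K s0 s \<Lambda> a)"
    and "\<And>j \<alpha>. (j, \<alpha>) \<in> \<Lambda> \<Longrightarrow> a j \<alpha> \<in> gevrey_fps M (inv_k1 K s0 s \<Lambda> a)"
    and "regular_M_sequence M s0 m0"
    and "formal_solution K m0 m \<Lambda> a f \<phi> u"
  shows "\<exists>r U. 0 < r \<and> r < R \<and> (\<forall>n. has_mps_expansion (U n) (u n)) \<and>
           U \<in> gevrey_holomorphic r M (inv_k1 K s0 s \<Lambda> a)"
proof -
  define \<kappa> where "\<kappa> = inv_k1 K s0 s \<Lambda> a"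
  obtain B where B: "B \<ge> 1" "\<And>n k. M (n + k) \<le> B ^ (n + k) * M n * M k"
    using moderate_growth_ge_1[OF assms(6,2,4)] by blast
  interpret weight_sequence M B
    by (rule weight_sequence.intro) (fact assms(2,4,5) B)+

  have \<kappa>: "\<kappa> \<ge> 0" unfolding \<kappa>_def inv_k1_def by (rule Max_ge) (use assms(11) in auto)
  \<comment> \<open>For a vanishing coefficient \<open>j\<close> is a default: all its Taylor
    coefficients are 0, and \<open>K \<ge> 1\<close> gives
    \<open>j < q j \<alpha> + K\<close>.\<close>
  define q where "q j \<alpha> = (if a j \<alpha> = 0 then j else subdegree (a j \<alpha>))" for j \<alpha>
  have q: "j < q j \<alpha> + K" if "(j, \<alpha>) \<in> \<Lambda>" for j \<alpha>
    using assms(12)[OF that] assms(1) by (cases "a j \<alpha> = 0") (simp_all add: q_def)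
  have q0: "fps_nth (a j \<alpha>) k = 0" if "k < q j \<alpha>" for j \<alpha> k
  proof (cases "a j \<alpha> = 0")
    case False
    then show ?thesis using that by (intro nth_less_subdegree_zero) (simp add: q_def)
  qed simp
  \<comment> \<open>The definition of \<open>\<kappa>\<close> with the positive denominator cleared;
    vanishing coefficients, whose quotient is set to 0, are excluded.\<close>
  have slope: "s0 * (real j - real K) + (\<Sum>i\<in>UNIV. s i * real (\<alpha> i)) \<le> \<kappa> * (real (q j \<alpha>) - real j + real K)"
    if "(j, \<alpha>) \<in> \<Lambda>" "a j \<alpha> \<noteq> 0" for j \<alpha>
  proof -
    have "(s0 * (real j - real K) + (\<Sum>i\<in>UNIV. s i * real (\<alpha> i))) / (real (subdegree (a j \<alpha>)) - real j + real K) \<le> \<kappa>"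
      unfolding \<kappa>_def inv_k1_def
      by (rule Max_ge[OF _ insertI2[OF image_eqI[of _ _ "(j, \<alpha>)"]]]) (use that assms(11) in auto)
    moreover have "real (q j \<alpha>) - real j + real K > 0" using q[OF that(1)] by linarith
    ultimately show ?thesis using that(2) by (simp add: q_def pos_divide_le_eq)
  qed

  have m0_pos: "m0 n > 0" for n using assms(9) by (simp add: M_sequence_def)
  obtain a0 A0 where m0: "a0 > 0" "A0 > 0" "\<And>n. a0 ^ n * M n powr s0 \<le> m0 n" "\<And>n. m0 n \<le> A0 ^ n * M n powr s0"
    using assms(9) unfolding M_sequence_def by blast
  have m_pos: "m i n > 0" for i n using assms(10) by (simp add: M_sequence_def)
  have "\<forall>i. \<exists>b A. b > 0 \<and> A > 0 \<and> (\<forall>n. b ^ n * M n powr s i \<le> m i n \<and> m i n \<le> A ^ n * M n powr s i)"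
    using assms(10) unfolding M_sequence_def by blast
  then obtain bm Am where m: "\<And>i. bm i > 0" "\<And>i. Am i > 0"
      "\<And>i n. bm i ^ n * M n powr s i \<le> m i n" "\<And>i n. m i n \<le> Am i ^ n * M n powr s i"
    by metis
  \<comment> \<open>There are finitely many variables, so the lower and upper constants can be
    chosen common to all of them.\<close>
  define b where "b = Min (range bm)"
  define A1 where "A1 = max 1 (Max (range Am))"
  have b: "b > 0" using m(1) by (simp add: b_def)
  have b_le: "b \<le> bm i" for i by (simp add: b_def)
  have A1: "A1 \<ge> 1" by (simp add: A1_def)
  have A1_ge: "Am i \<le> A1" for i by (simp add: A1_def le_max_iff_disj)
  have mb: "b ^ n * M n powr s i \<le> m i n" "m i n \<le> A1 ^ n * M n powr s i" for i n
  proof -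
    have "b ^ n * M n powr s i \<le> bm i ^ n * M n powr s i"
      using b b_le by (intro mult_right_mono power_mono) auto
    then show "b ^ n * M n powr s i \<le> m i n" using m(3) by (rule order_trans)
    have "Am i ^ n * M n powr s i \<le> A1 ^ n * M n powr s i"
      using A1_ge m(2)[of i] by (intro mult_right_mono power_mono) auto
    with m(4)[of i n] show "m i n \<le> A1 ^ n * M n powr s i" by (rule order_trans)
  qed
  obtain Ar where Ar: "Ar > 0" "\<And>n. n \<ge> 1 \<Longrightarrow> m0 n / m0 (n - 1) \<le> Ar * (M n / M (n - 1)) powr s0"
    using assms(17) unfolding regular_M_sequence_def by blast

  \<comment> \<open>Cauchy estimates for the source and the initial data\<close>
  define F where "F n = P_op K m0 m \<Lambda> a u n" for n
  have hol_f: "holomorphic_several (f n) (polydisc R)" for n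
    using assms(15) by (simp add: gevrey_holomorphic_def)
  have "\<exists>A>0. \<exists>B>0. \<forall>z\<in>polydisc (R / 2). \<forall>n. cmod (f n z) \<le> A * B ^ n * M n powr \<kappa>"
    using assms(13,15) unfolding gevrey_holomorphic_def \<kappa>_def by simp
  then obtain Af Bf where f: "Af > 0" "Bf > 0"
      "\<And>z n. z \<in> polydisc (R / 2) \<Longrightarrow> cmod (f n z) \<le> Af * Bf ^ n * M n powr \<kappa>"
    by blast
  \<comment> \<open>Bounds hold on radius \<open>R / 2\<close>, and \<open>R / 4\<close> lies
    strictly inside it, as the Cauchy estimate requires.\<close>
  define r where "r = R / 4"
  have r: "0 < r" "r < R / 2" using assms(13) by (simp_all add: r_def)
  have half: "polydisc (R / 2) \<subseteq> (polydisc R :: (complex ^ 'n) set)"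
    using assms(13) by (intro polydisc_mono) simp
  have F: "cmod (F n \<gamma>) * r ^ (\<Sum>i\<in>UNIV. \<gamma> i) \<le> Af * Bf ^ n * M n powr \<kappa>" for n \<gamma>
  proof (rule has_mps_expansion_Cauchy_estimate[OF holomorphic_several_subset[OF hol_f half] _ r f(3)])
    show "has_mps_expansion (f n) (F n)"
      using assms(18) by (simp add: formal_solution_def F_def)
  qed
  have "\<forall>j\<in>{..<K}. \<exists>b>0. \<forall>z\<in>polydisc (R / 2). cmod (\<phi> j z) \<le> b"
  proof
    fix j assume "j \<in> {..<K}"
    then obtain b where "b > 0" "\<And>z. z \<in> polydisc (R / 2) \<Longrightarrow> cmod (\<phi> j z) \<le> b"
      using holomorphic_several_bounded[OF assms(14), of j "R / 2"] assms(13) by auto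
    then show "\<exists>b>0. \<forall>z\<in>polydisc (R / 2). cmod (\<phi> j z) \<le> b" by blast
  qed
  then obtain \<beta> where \<beta>: "\<And>j. j < K \<Longrightarrow> \<beta> j > 0"
      "\<And>j z. j < K \<Longrightarrow> z \<in> polydisc (R / 2) \<Longrightarrow> cmod (\<phi> j z) \<le> \<beta> j"
    unfolding bchoice_iff by auto
  \<comment> \<open>At \<open>t = 0\<close> the operator of order \<open>N\<close> multiplies
    \<open>u N\<close> by \<open>m0 N / m0 0\<close>, whence the factor \<open>m0 0\<close>.\<close>
  define \<Phi> where "\<Phi> = m0 0 * (\<Sum>j<K. \<beta> j)"
  have \<Phi>: "\<Phi> > 0" unfolding \<Phi>_def using assms(1) \<beta>(1) m0_pos
    by (intro mult_pos_pos sum_pos) (auto simp: lessThan_empty_iff)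
  have init: "m0 N * cmod (u N \<gamma>) * r ^ (\<Sum>i\<in>UNIV. \<gamma> i) \<le> \<Phi>" if "N < K" for N \<gamma>
  proof -
    have "cmod ((mdiff_t m0 ^^ N) u 0 \<gamma>) * r ^ (\<Sum>i\<in>UNIV. \<gamma> i) \<le> \<beta> N"
    proof (rule has_mps_expansion_Cauchy_estimate[OF holomorphic_several_subset[OF assms(14)[OF that] half] _ r \<beta>(2)[OF that]])
      show "has_mps_expansion (\<phi> N) ((mdiff_t m0 ^^ N) u 0)"
        using assms(18) that by (simp add: formal_solution_def)
    qed
    also have "\<beta> N \<le> (\<Sum>j<K. \<beta> j)"
      using that \<beta>(1) by (intro member_le_sum) (auto intro: less_imp_le)
    finally have "m0 0 * (cmod ((mdiff_t m0 ^^ N) u 0 \<gamma>) * r ^ (\<Sum>i\<in>UNIV. \<gamma> i)) \<le> \<Phi>"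
      unfolding \<Phi>_def using m0_pos[of 0] by (intro mult_left_mono) auto
    then show ?thesis
      using m0_pos[of 0] m0_pos[of N] by (simp add: mdiff_t_funpow[OF m0_pos] norm_mult norm_divide)
  qed

  \<comment> \<open>Bounds for the coefficients of the recursion\<close>
  have "\<forall>p\<in>\<Lambda>. \<exists>A B. A > 0 \<and> B > 0 \<and> (\<forall>n. cmod (fps_nth (a (fst p) (snd p)) n) \<le> A * B ^ n * M n powr \<kappa>)"
  proof
    fix p assume "p \<in> \<Lambda>"
    then have "a (fst p) (snd p) \<in> gevrey_fps M \<kappa>" unfolding \<kappa>_def by (intro assms(16)) simp
    then show "\<exists>A B. A > 0 \<and> B > 0 \<and> (\<forall>n. cmod (fps_nth (a (fst p) (snd p)) n) \<le> A * B ^ n * M n powr \<kappa>)"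
      unfolding gevrey_fps_def by blast
  qed
  then obtain Aa Ba where a: "\<And>p. p \<in> \<Lambda> \<Longrightarrow> Aa p > 0" "\<And>p. p \<in> \<Lambda> \<Longrightarrow> Ba p > 0"
      "\<And>p n. p \<in> \<Lambda> \<Longrightarrow> cmod (fps_nth (a (fst p) (snd p)) n) \<le> Aa p * Ba p ^ n * M n powr \<kappa>"
    by metis
  \<comment> \<open>Sums over the finite set \<open>\<Lambda>\<close> serve as common upper bounds,
    here and for \<open>A\<close> below; the summand 1 gives \<open>Q \<ge> 1\<close>, also for
    empty \<open>\<Lambda>\<close>.\<close>
  define Q where "Q = 1 + (\<Sum>p\<in>\<Lambda>. Ba p * Ar)"
  have Q1: "Q \<ge> 1" unfolding Q_def
    using sum_nonneg[OF mult_nonneg_nonneg[OF less_imp_le[OF a(2)] less_imp_le[OF Ar(1)]]] by simp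
  have Q_ge: "Ba p * Ar \<le> Q" if "p \<in> \<Lambda>" for p
  proof -
    have "Ba p * Ar \<le> (\<Sum>p\<in>\<Lambda>. Ba p * Ar)"
      using that a(2) Ar(1) assms(11) by (intro member_le_sum) (auto intro: less_imp_le)
    then show ?thesis by (simp add: Q_def)
  qed
  define h where "h p = Aa p * M (q (fst p) (snd p)) powr \<kappa> * Q ^ fst p" for p
  have h: "h p \<ge> 0" if "p \<in> \<Lambda>" for p using a(1)[OF that] Q1 by (simp add: h_def)
  define A where "A = (\<Sum>p\<in>\<Lambda>. h p)"
  have A_ge: "h p \<le> A" if "p \<in> \<Lambda>" for p
    unfolding A_def using that h assms(11) by (intro member_le_sum) auto
  have A: "A \<ge> 0" unfolding A_def using h by (rule sum_nonneg)

  define c where "c j \<alpha> n k = cmod (fps_nth (a j \<alpha>) k) * (m0 n / m0 (n - k))" for j \<alpha> n k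
  have c: "0 \<le> c j \<alpha> n k \<and> c j \<alpha> n k \<le> A * Q ^ (k + K - j) *
      ratio N powr ((\<kappa> + s0) * real (k + K - j) - (\<Sum>i\<in>UNIV. s i * \<alpha> i))"
    if \<Lambda>: "(j, \<alpha>) \<in> \<Lambda>" and k: "q j \<alpha> \<le> k" "k \<le> n" "n + K \<le> N" for N j \<alpha> n k
  proof
    show "0 \<le> c j \<alpha> n k" using m0_pos[of n] m0_pos[of "n - k"] by (simp add: c_def)
    show "c j \<alpha> n k \<le> A * Q ^ (k + K - j) *
        ratio N powr ((\<kappa> + s0) * real (k + K - j) - (\<Sum>i\<in>UNIV. s i * \<alpha> i))"
    \<comment> \<open>\<open>slope\<close> is available only for nonzero coefficients; otherwise the
      left side is 0.\<close>
    proof (cases "a j \<alpha> = 0")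
      case True
      then show ?thesis using A Q1 by (simp add: c_def)
    next
      case False
      have "c j \<alpha> n k \<le> h (j, \<alpha>) * Q ^ (k + K - j) *
          ratio N powr ((\<kappa> + s0) * real (k + K - j) - (\<Sum>i\<in>UNIV. s i * \<alpha> i))"
        unfolding c_def h_def fst_conv snd_conv
      proof (rule gevrey_coefficient_le[where A' = Ar and b = "Ba (j, \<alpha>)"])
        show "m0 n / m0 (n - k) \<le> Ar ^ k * ratio N powr (s0 * real k)"
          using k by (intro regular_quotient_le m0_pos Ar assms(7)) auto
      qed (use a[OF \<Lambda>] \<kappa> m0_pos[of n] m0_pos[of "n - k"] k q[OF \<Lambda>] slope[OF \<Lambda> False] Q1 Q_ge[OF \<Lambda>] Ar(1) in
          \<open>auto intro: less_imp_le\<close>)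
      also have "\<dots> \<le> A * Q ^ (k + K - j) *
          ratio N powr ((\<kappa> + s0) * real (k + K - j) - (\<Sum>i\<in>UNIV. s i * \<alpha> i))"
        using A_ge[OF \<Lambda>] Q1 by (intro mult_right_mono) auto
      finally show ?thesis .
    qed
  qed
  have "\<exists>C>0. \<exists>H>0. \<exists>G>0. \<forall>n \<gamma>. cmod (u n \<gamma>) \<le> C * H ^ n * M n powr \<kappa> * G ^ (\<Sum>i\<in>UNIV. \<gamma> i)"
  proof (rule coefficient_bound[where c = c and q = q and K = K and F = F and \<Lambda> = \<Lambda>, OF \<kappa> assms(7,8) m0(3,4,1,2) mb b A1
        F r(1) f(2) init f(1) \<Phi> A _ assms(11) _ q c])
    show "0 \<le> Q" using Q1 by simp
    show "m0 (n + K) * (\<Prod>i\<in>UNIV. m i (\<gamma> i)) * cmod (u (n + K) \<gamma>) \<le>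
        m0 n * (\<Prod>i\<in>UNIV. m i (\<gamma> i)) * cmod (F n \<gamma>) +
        (\<Sum>(j, \<alpha>)\<in>\<Lambda>. \<Sum>k=q j \<alpha>..n. c j \<alpha> n k *
          (m0 (n - k + j) * (\<Prod>i\<in>UNIV. m i (\<gamma> i + \<alpha> i)) * cmod (u (n - k + j) (\<lambda>i. \<gamma> i + \<alpha> i))))" for n \<gamma>
      unfolding F_def c_def by (rule weighted_recursion[where q = q, OF m0_pos m_pos q0])
  qed
  then show ?thesis
    unfolding \<kappa>_def[symmetric] using gevrey_holomorphic_of_coefficients assms(13) by blast
qed

end
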